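(* Let $\lambda\ge0$, $\gamma>0$, $x\ge0$, let $\Delta:[0,\infty)\to[0,\infty)$ be continuous and let $\hat X$ be the generalized squared Bessel process, i.e. the unique nonnegative solution of $$d\hat X_t=2\sqrt{\hat X_t}\,dB_t+\Delta(t)\,dt,\qquad\hat X_0=x .$$ Then for $t\ge0$ $$\mathbb E e^{-\lambda\hat X_t-\gamma\int_0^t\hat X_udu}=e^{-x\phi(t,\lambda)-\psi(t,\lambda)},$$ where, with $\alpha=\sqrt{\gamma/2}$, $$\phi(t,\lambda)=\alpha\Big[1+\frac{2(\lambda-\alpha)}{2\alpha e^{4\alpha t}-(\lambda-\alpha)(1-e^{4\alpha t})}\Big],\qquad \psi(t,\lambda)=\int_0^t\Delta(u)y_{x_0}(u)\,du\Big|_{x_0=\phi(t,\lambda)},$$ $$y_{x_0}(t)=\alpha\Big[1+\frac{2(x_0-\alpha)e^{4\alpha t}}{2\alpha+(x_0-\alpha)(1-e^{4\alpha t})}\Big].$$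
   Context: $B$ is a standard Brownian motion. *)

theory Defs
  imports "HOL-Probability.Probability"
begin

section \<open>Brownian motion relative to a filtration\<close>

text \<open>
  Time is indexed by \<^typ>\<open>real\<close>, but only nonnegative times are ever used; a filtration
  on \<open>[0,\<infinity>)\<close> is extended to negative times by \<open>F 0\<close>. No completeness or right-continuity
  of the filtration is required.
\<close>

locale filtered_prob_space = prob_space M + filtration "space M" F
  for M :: "'a measure" and F :: "real \<Rightarrow> 'a measure" +
  assumes sets_F_subset: "\<And>t. sets (F t) \<subseteq> sets M"

locale brownian_motion = filtered_prob_space M F
  for M :: "'a measure" and F :: "real \<Rightarrow> 'a measure" +
  fixes B :: "real \<Rightarrow> 'a \<Rightarrow> real"
  assumes adapted: "\<And>t. 0 \<le> t \<Longrightarrow> B t \<in> borel_measurable (F t)"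
    and starts_at_0: "AE \<omega> in M. B 0 \<omega> = 0"
    and continuous_paths: "AE \<omega> in M. continuous_on {0..} (\<lambda>t. B t \<omega>)"
    and normal_increments: "\<And>s t. 0 \<le> s \<Longrightarrow> s < t \<Longrightarrow>
          distributed M lborel (\<lambda>\<omega>. B t \<omega> - B s \<omega>) (normal_density 0 (sqrt (t - s)))"
    and independent_increments: "\<And>s t. 0 \<le> s \<Longrightarrow> s < t \<Longrightarrow>
          indep_set (sets (F s)) {(\<lambda>\<omega>. B t \<omega> - B s \<omega>) -` A \<inter> space M | A. A \<in> sets borel}"

section \<open>The Ito integral\<close>

text \<open>
  The triple \<open>(n, \<tau>, \<xi>)\<close> stands for the elementary process
  \<open>\<Sum>i<n. \<xi>\<^sub>i 1\<^bsub>(\<tau>\<^sub>i, \<tau>\<^sub>i\<^sub>+\<^sub>1]\<^esub>\<close> with deterministic times \<open>\<tau>\<^sub>0 \<le> \<dots> \<le> \<tau>\<^sub>n\<close>.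
\<close>

type_synonym 'a elementary = "nat \<times> (nat \<Rightarrow> real) \<times> (nat \<Rightarrow> 'a \<Rightarrow> real)"

definition elementary :: "'a measure \<Rightarrow> (real \<Rightarrow> 'a measure) \<Rightarrow> 'a elementary \<Rightarrow> bool" where
  "elementary M F = (\<lambda>(n, \<tau>, \<xi>).
     0 \<le> \<tau> 0 \<and> (\<forall>i<n. \<tau> i \<le> \<tau> (Suc i)) \<and>
     (\<forall>i<n. \<xi> i \<in> borel_measurable (F (\<tau> i))) \<and>
     (\<exists>K. \<forall>i<n. \<forall>\<omega>\<in>space M. \<bar>\<xi> i \<omega>\<bar> \<le> K))"

definition elementary_value :: "'a elementary \<Rightarrow> real \<Rightarrow> 'a \<Rightarrow> real" where
  "elementary_value = (\<lambda>(n, \<tau>, \<xi>) s \<omega>.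
     \<Sum>i<n. \<xi> i \<omega> * indicator {\<tau> i<..\<tau> (Suc i)} s)"

definition elementary_integral ::
    "(real \<Rightarrow> 'a \<Rightarrow> real) \<Rightarrow> 'a elementary \<Rightarrow> real \<Rightarrow> 'a \<Rightarrow> real" where
  "elementary_integral B = (\<lambda>(n, \<tau>, \<xi>) t \<omega>.
     \<Sum>i<n. \<xi> i \<omega> * (B (min t (\<tau> (Suc i))) \<omega> - B (min t (\<tau> i)) \<omega>))"

definition progressive :: "(real \<Rightarrow> 'a measure) \<Rightarrow> (real \<Rightarrow> 'a \<Rightarrow> real) \<Rightarrow> bool" where
  "progressive F H \<longleftrightarrow>
     (\<forall>t\<ge>0. (\<lambda>(s, \<omega>). H s \<omega>) \<in> borel_measurable (restrict_space borel {0..t} \<Otimes>\<^sub>M F t))"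

definition tendsto_in_prob :: "'a measure \<Rightarrow> (nat \<Rightarrow> 'a \<Rightarrow> real) \<Rightarrow> ('a \<Rightarrow> real) \<Rightarrow> bool" where
  "tendsto_in_prob M Y Z \<longleftrightarrow>
     (\<forall>\<epsilon>>0. (\<lambda>n. measure M {\<omega> \<in> space M. \<bar>Y n \<omega> - Z \<omega>\<bar> > \<epsilon>}) \<longlonglongrightarrow> 0)"

text \<open>
  \<open>\<integral>\<^sub>0\<^sup>t (S n - H)\<^sup>2 ds \<rightarrow> 0\<close> in probability for every \<open>t\<close>. The integral is taken in
  \<^typ>\<open>ennreal\<close>, so that it is \<open>\<infinity>\<close>, not \<open>0\<close>, where the integrand is not integrable.
\<close>

definition approximates ::
    "'a measure \<Rightarrow> (nat \<Rightarrow> 'a elementary) \<Rightarrow> (real \<Rightarrow> 'a \<Rightarrow> real) \<Rightarrow> bool" where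
  "approximates M S H \<longleftrightarrow>
     (\<forall>t\<ge>0. \<forall>\<epsilon>>0. (\<lambda>n. measure M {\<omega> \<in> space M.
        (\<integral>\<^sup>+s\<in>{0..t}. ennreal ((elementary_value (S n) s \<omega> - H s \<omega>)\<^sup>2) \<partial>lborel) > ennreal \<epsilon>})
        \<longlonglongrightarrow> 0)"

text \<open>
  \<open>I\<close> is the stochastic integral process \<open>I t = \<integral>\<^sub>0\<^sup>t H dB\<close> of a progressive process \<open>H\<close> with
  locally square integrable paths: the continuous process that is the limit in probability of
  the integrals of elementary processes approximating \<open>H\<close>. By the standard theory, approximating
  sequences exist and the limit does not depend on the choice of the sequence; hence the
  existence clause is redundant, and only rules out that the last clause holds vacuously.
\<close>

definition ito_integral ::
    "'a measure \<Rightarrow> (real \<Rightarrow> 'a measure) \<Rightarrow> (real \<Rightarrow> 'a \<Rightarrow> real) \<Rightarrow>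
     (real \<Rightarrow> 'a \<Rightarrow> real) \<Rightarrow> (real \<Rightarrow> 'a \<Rightarrow> real) \<Rightarrow> bool" where
  "ito_integral M F B H I \<longleftrightarrow>
     progressive F H \<and>
     (AE \<omega> in M. \<forall>t\<ge>0. (\<integral>\<^sup>+s\<in>{0..t}. ennreal ((H s \<omega>)\<^sup>2) \<partial>lborel) < \<infinity>) \<and>
     (\<forall>t\<ge>0. I t \<in> borel_measurable M) \<and>
     (AE \<omega> in M. continuous_on {0..} (\<lambda>t. I t \<omega>)) \<and>
     (\<exists>S. (\<forall>n. elementary M F (S n)) \<and> approximates M S H) \<and>
     (\<forall>S. (\<forall>n. elementary M F (S n)) \<and> approximates M S H \<longrightarrow>
        (\<forall>t\<ge>0. tendsto_in_prob M (\<lambda>n. elementary_integral B (S n) t) (I t)))"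

section \<open>Generalized squared Bessel processes\<close>

text \<open>
  Nonnegative solutions of \<open>dX\<^sub>t = 2 \<surd>X\<^sub>t dB\<^sub>t + \<Delta>(t) dt\<close>, \<open>X\<^sub>0 = x\<close>. Progressive measurability
  makes path integrals such as \<open>\<integral>\<^sub>0\<^sup>t X\<^sub>u du\<close> measurable although path properties are only
  required almost surely; it is automatic for adapted processes all of whose paths are continuous.
\<close>

definition generalized_squared_bessel ::
    "'a measure \<Rightarrow> (real \<Rightarrow> 'a measure) \<Rightarrow> (real \<Rightarrow> 'a \<Rightarrow> real) \<Rightarrow>
     (real \<Rightarrow> real) \<Rightarrow> real \<Rightarrow> (real \<Rightarrow> 'a \<Rightarrow> real) \<Rightarrow> bool" where
  "generalized_squared_bessel M F B \<Delta> x X \<longleftrightarrow>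
     progressive F X \<and>
     (AE \<omega> in M. continuous_on {0..} (\<lambda>t. X t \<omega>)) \<and>
     (AE \<omega> in M. \<forall>t\<ge>0. 0 \<le> X t \<omega>) \<and>
     (AE \<omega> in M. X 0 \<omega> = x) \<and>
     (\<exists>I. ito_integral M F B (\<lambda>t \<omega>. 2 * sqrt (X t \<omega>)) I \<and>
        (AE \<omega> in M. \<forall>t\<ge>0. X t \<omega> = x + I t \<omega> + (LBINT u:{0..t}. \<Delta> u)))"

section \<open>The functions in the Laplace transform\<close>

definition phi :: "real \<Rightarrow> real \<Rightarrow> real \<Rightarrow> real" where
  "phi \<alpha> t l = \<alpha> * (1 + 2 * (l - \<alpha>) /
     (2 * \<alpha> * exp (4 * \<alpha> * t) - (l - \<alpha>) * (1 - exp (4 * \<alpha> * t))))"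

definition y_flow :: "real \<Rightarrow> real \<Rightarrow> real \<Rightarrow> real" where
  "y_flow \<alpha> x\<^sub>0 t = \<alpha> * (1 + 2 * (x\<^sub>0 - \<alpha>) * exp (4 * \<alpha> * t) /
     (2 * \<alpha> + (x\<^sub>0 - \<alpha>) * (1 - exp (4 * \<alpha> * t))))"

definition psi :: "real \<Rightarrow> (real \<Rightarrow> real) \<Rightarrow> real \<Rightarrow> real \<Rightarrow> real" where
  "psi \<alpha> \<Delta> t l = (LBINT u:{0..t}. \<Delta> u * y_flow \<alpha> (phi \<alpha> t l) u)"

end

theory Submission
  imports Defs
begin

text \<open>
  Let \<open>y\<close> solve \<open>y' = 2 y\<^sup>2 - \<gamma>\<close>, \<open>y(t) = \<lambda>\<close>, so that \<open>y(0) = \<phi>(t, \<lambda>)\<close>. Integrating \<open>y X\<close> by parts shows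
  that \<open>- \<lambda> X\<^sub>t - \<gamma> \<integral>\<^sub>0\<^sup>t X du + x \<phi> + \<psi>\<close> is the exponent \<open>\<integral> \<theta> dB - (1/2) \<integral> \<theta>\<^sup>2 du\<close> of a stochastic
  exponential with \<open>\<theta> = - 2 y \<surd>X\<close>, and the claim is that this exponential has expectation \<open>1\<close>.

  For elementary integrands this is an exact computation with Gaussian increments. Stop the
  elementary integrands when the quadratic variation \<open>\<integral> 4 X du\<close> exceeds \<open>K\<close>; then the exponentials are
  bounded in \<open>L\<^sup>2\<close>. What is lost is the probability of stopping under the changed measure. There \<open>X\<close>
  has the additional drift \<open>- 4 y X \<le> 0\<close>, hence is dominated by a martingale whose second moment is
  at most the expected quadratic variation \<open>v\<close>; this gives \<open>v \<le> c + v/2\<close> with \<open>c\<close> independent of \<open>K\<close>,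
  and Markov's inequality concludes. No maximal inequality is needed, because only finitely
  many times of a coarse grid enter for each approximation.
\<close>

section \<open>Gaussian increments\<close>

text \<open>The two inequalities for E exp W behave differently. For the upper bound K may grow with
  the grid: \<open>exp W\<close> is bounded, so a bad event of small probability costs little, and K
  is taken so large that stopping never occurs. For the lower bound, mass of the exponential could
  escape to the bad event or to the stopped paths. The second-moment bound
  \<open>exp (C\<^sup>2 * K)\<close> controls the bad event once K is fixed before the grid, and the
  bound on v, being independent of K, controls the stopped paths. Two nested grids are forced by a
  notion of Ito integral that speaks of one fixed time at a time. With y frozen on a coarse cell,
  the stochastic sum over the cell is nearly an increment of X minus its drift, so m + 1 fixed times
  suffice while the fine mesh shrinks; the coarse mesh is then treated path by path, by real
  analysis. The changed measure never occurs as a measure: its expectations are integrals against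
  the weight E.\<close>

text \<open>Completing the square turns the exponential weight into a shift of the mean to g
  \<sigma>^2 (Cameron-Martin for one Gaussian). After centring there, the cross term
  vanishes.\<close>

lemma nn_integral_tilted_normal_density:
  fixes a b g \<sigma> :: real
  assumes \<sigma>: "0 < \<sigma>"
  shows "(\<integral>\<^sup>+z. ennreal (normal_density 0 \<sigma> z) *
            ennreal (exp (g * z - g\<^sup>2 * \<sigma>\<^sup>2 / 2) * (a + b * (z - g * \<sigma>\<^sup>2))\<^sup>2) \<partial>lborel)
         = ennreal (a\<^sup>2 + b\<^sup>2 * \<sigma>\<^sup>2)"
proof -
  define \<mu> where "\<mu> = g * \<sigma>\<^sup>2"
  have tilt: "normal_density 0 \<sigma> z * exp (g * z - g\<^sup>2 * \<sigma>\<^sup>2 / 2) = normal_density \<mu> \<sigma> z" for z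
  proof -
    have "- (z - 0)\<^sup>2 / (2 * \<sigma>\<^sup>2) + (g * z - g\<^sup>2 * \<sigma>\<^sup>2 / 2) = - (z - \<mu>)\<^sup>2 / (2 * \<sigma>\<^sup>2)"
      using \<sigma> by (simp add: \<mu>_def field_simps power2_eq_square)
    then show ?thesis
      by (simp add: normal_density_def exp_add[symmetric] del: diff_0_right)
  qed
  have m0: "has_bochner_integral lborel (normal_density \<mu> \<sigma>) 1"
    using integrable_normal_density[OF \<sigma>] integral_normal_density[OF \<sigma>]
    by (auto simp: has_bochner_integral_iff)
  have m1: "has_bochner_integral lborel (\<lambda>z. normal_density \<mu> \<sigma> z * (z - \<mu>)) 0"
    using normal_moment_odd[OF \<sigma>, of \<mu> 0] by simp
  have m2: "has_bochner_integral lborel (\<lambda>z. normal_density \<mu> \<sigma> z * (z - \<mu>)\<^sup>2) (\<sigma>\<^sup>2)"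
    using normal_moment_even[OF \<sigma>, of \<mu> 1] \<sigma> by (simp add: fact_numeral field_simps power2_eq_square)
  have "has_bochner_integral lborel
      (\<lambda>z. a\<^sup>2 * normal_density \<mu> \<sigma> z + (2 * a * b * (normal_density \<mu> \<sigma> z * (z - \<mu>))
         + b\<^sup>2 * (normal_density \<mu> \<sigma> z * (z - \<mu>)\<^sup>2))) (a\<^sup>2 * 1 + (2 * a * b * 0 + b\<^sup>2 * \<sigma>\<^sup>2))"
    by (intro has_bochner_integral_add has_bochner_integral_mult_right m0 m1 m2)
  moreover have "a\<^sup>2 * normal_density \<mu> \<sigma> z + (2 * a * b * (normal_density \<mu> \<sigma> z * (z - \<mu>))
         + b\<^sup>2 * (normal_density \<mu> \<sigma> z * (z - \<mu>)\<^sup>2)) = normal_density \<mu> \<sigma> z * (a + b * (z - \<mu>))\<^sup>2" for z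
    by (simp add: power2_eq_square algebra_simps)
  ultimately have *: "has_bochner_integral lborel (\<lambda>z. normal_density \<mu> \<sigma> z * (a + b * (z - \<mu>))\<^sup>2)
      (a\<^sup>2 + b\<^sup>2 * \<sigma>\<^sup>2)" by simp
  have "(\<integral>\<^sup>+z. ennreal (normal_density 0 \<sigma> z) *
            ennreal (exp (g * z - g\<^sup>2 * \<sigma>\<^sup>2 / 2) * (a + b * (z - g * \<sigma>\<^sup>2))\<^sup>2) \<partial>lborel)
     = (\<integral>\<^sup>+z. ennreal (normal_density \<mu> \<sigma> z * (a + b * (z - \<mu>))\<^sup>2) \<partial>lborel)"
    by (simp add: ennreal_mult''[symmetric] tilt[symmetric] mult.assoc flip: \<mu>_def)
  also have "\<dots> = ennreal (a\<^sup>2 + b\<^sup>2 * \<sigma>\<^sup>2)"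
    using * by (subst nn_integral_eq_integral) (auto simp: has_bochner_integral_iff)
  finally show ?thesis .
qed

context brownian_motion
begin

lemma measurable_F_M:
  assumes "f \<in> measurable (F s) N"
  shows "f \<in> measurable M N"
proof -
  have "subalgebra M (F s)" using sets_F_subset[of s] by (simp add: subalgebra_def space_F)
  then show ?thesis using assms by (rule measurable_from_subalg)
qed

lemma measurable_F_le:
  assumes "f \<in> measurable (F s) N" "s \<le> u"
  shows "f \<in> measurable (F u) N"
proof -
  have "subalgebra (F u) (F s)" using sets_F_mono[OF assms(2)] by (simp add: subalgebra_def space_F)
  then show ?thesis using assms(1) by (rule measurable_from_subalg)
qed

lemma adapted_le: "0 \<le> s \<Longrightarrow> s \<le> u \<Longrightarrow> B s \<in> borel_measurable (F u)"
  by (rule measurable_F_le[OF adapted])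

text \<open>Freezing: W is independent of the increment, so the joint law is a product and the
  increment is integrated out with W held fixed. The target space N is arbitrary so that W can
  bundle several random variables.\<close>

lemma nn_integral_gaussian_increment:
  assumes "0 \<le> s" "s < u" and W[measurable]: "W \<in> measurable (F s) N"
    and f[measurable]: "f \<in> borel_measurable (N \<Otimes>\<^sub>M borel)"
  shows "(\<integral>\<^sup>+\<omega>. f (W \<omega>, B u \<omega> - B s \<omega>) \<partial>M)
       = (\<integral>\<^sup>+\<omega>. (\<integral>\<^sup>+z. ennreal (normal_density 0 (sqrt (u - s)) z) * f (W \<omega>, z) \<partial>lborel) \<partial>M)"
proof -
  define D where "D = (\<lambda>\<omega>. B u \<omega> - B s \<omega>)"
  have [measurable]: "W \<in> measurable M N" using W by (rule measurable_F_M)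
  have dist: "distributed M lborel D (normal_density 0 (sqrt (u - s)))"
    using normal_increments[OF assms(1,2)] by (simp add: D_def)
  have [measurable]: "D \<in> borel_measurable M"
    using distributed_measurable[OF dist] by simp
  interpret D: prob_space "distr M borel D" by (rule prob_space_distr) simp
  interpret W: prob_space "distr M N W" by (rule prob_space_distr) simp
  have eq: "distr M N W \<Otimes>\<^sub>M distr M borel D = distr M (N \<Otimes>\<^sub>M borel) (\<lambda>\<omega>. (W \<omega>, D \<omega>))"
  proof (rule pair_measure_eqI)
    show "sets (distr M N W \<Otimes>\<^sub>M distr M borel D) = sets (distr M (N \<Otimes>\<^sub>M borel) (\<lambda>\<omega>. (W \<omega>, D \<omega>)))"
      by (simp cong: sets_pair_measure_cong)
  next
    fix A C assume A: "A \<in> sets (distr M N W)" and C: "C \<in> sets (distr M borel D)"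
    have "W -` A \<inter> space M \<in> sets (F s)"
      using measurable_sets[OF W, of A] A by (simp add: space_F)
    moreover have "indep_set (sets (F s)) {D -` A \<inter> space M |A. A \<in> sets borel}"
      using independent_increments[OF assms(1,2)] by (simp add: D_def)
    ultimately have "prob ((W -` A \<inter> space M) \<inter> (D -` C \<inter> space M))
        = prob (W -` A \<inter> space M) * prob (D -` C \<inter> space M)"
      using C by (intro indep_setD) auto
    moreover have "(\<lambda>\<omega>. (W \<omega>, D \<omega>)) -` (A \<times> C) \<inter> space M = (W -` A \<inter> space M) \<inter> (D -` C \<inter> space M)"
      by auto
    ultimately show "emeasure (distr M N W) A * emeasure (distr M borel D) C
        = emeasure (distr M (N \<Otimes>\<^sub>M borel) (\<lambda>\<omega>. (W \<omega>, D \<omega>))) (A \<times> C)"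
      using A C by (simp add: emeasure_distr emeasure_eq_measure ennreal_mult)
  qed unfold_locales
  have dD: "distr M borel D = density lborel (normal_density 0 (sqrt (u - s)))"
    using distributed_distr_eq_density[OF dist]
    by (metis distr_cong sets_lborel)
  have "(\<integral>\<^sup>+\<omega>. f (W \<omega>, D \<omega>) \<partial>M) = (\<integral>\<^sup>+p. f p \<partial>(distr M (N \<Otimes>\<^sub>M borel) (\<lambda>\<omega>. (W \<omega>, D \<omega>))))"
    by (subst nn_integral_distr) simp_all
  also have "\<dots> = (\<integral>\<^sup>+w. (\<integral>\<^sup>+z. f (w, z) \<partial>distr M borel D) \<partial>distr M N W)"
    unfolding eq[symmetric] by (subst D.nn_integral_fst) (simp_all cong: measurable_cong_sets)
  also have "\<dots> = (\<integral>\<^sup>+\<omega>. (\<integral>\<^sup>+z. f (W \<omega>, z) \<partial>distr M borel D) \<partial>M)"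
    by (subst nn_integral_distr) (simp_all cong: measurable_cong_sets)
  also have "\<dots> = (\<integral>\<^sup>+\<omega>. (\<integral>\<^sup>+z. ennreal (normal_density 0 (sqrt (u - s)) z) * f (W \<omega>, z) \<partial>lborel) \<partial>M)"
    unfolding dD 
    by (intro nn_integral_cong, subst nn_integral_density) (auto simp: space_F intro!: measurable_compose[OF _ f] dest: measurable_space[OF W])
  finally show ?thesis by (simp add: D_def)
qed

lemma nn_integral_tilted_increment:
  assumes "0 \<le> s" "s < u"
    and [measurable]: "L \<in> borel_measurable (F s)" "A \<in> borel_measurable (F s)"
      "G \<in> borel_measurable (F s)" "H \<in> borel_measurable (F s)"
    and L: "\<And>\<omega>. 0 \<le> L \<omega>"
  shows "(\<integral>\<^sup>+\<omega>. ennreal (L \<omega> * exp (G \<omega> * (B u \<omega> - B s \<omega>) - (G \<omega>)\<^sup>2 * (u - s) / 2)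
             * (A \<omega> + H \<omega> * (B u \<omega> - B s \<omega> - G \<omega> * (u - s)))\<^sup>2) \<partial>M)
       = (\<integral>\<^sup>+\<omega>. ennreal (L \<omega> * ((A \<omega>)\<^sup>2 + (H \<omega>)\<^sup>2 * (u - s))) \<partial>M)"
proof -
  define f where "f = (\<lambda>p :: (real \<times> real \<times> real \<times> real) \<times> real.
      case p of ((l, a, g, b), z) \<Rightarrow> ennreal (l * (exp (g * z - g\<^sup>2 * (u - s) / 2)
             * (a + b * (z - g * (u - s)))\<^sup>2)))"
  define W where "W = (\<lambda>\<omega>. (L \<omega>, A \<omega>, G \<omega>, H \<omega>))"
  have [measurable]: "f \<in> borel_measurable ((borel \<Otimes>\<^sub>M borel \<Otimes>\<^sub>M borel \<Otimes>\<^sub>M borel) \<Otimes>\<^sub>M borel)"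
    unfolding f_def split_beta by measurable
  have [measurable]: "W \<in> measurable (F s) (borel \<Otimes>\<^sub>M borel \<Otimes>\<^sub>M borel \<Otimes>\<^sub>M borel)"
    unfolding W_def by measurable
  have sq: "(sqrt (u - s))\<^sup>2 = u - s" "0 < sqrt (u - s)" using assms(2) by auto
  have "(\<integral>\<^sup>+z. ennreal (normal_density 0 (sqrt (u - s)) z) * f (W \<omega>, z) \<partial>lborel)
     = ennreal (L \<omega> * ((A \<omega>)\<^sup>2 + (H \<omega>)\<^sup>2 * (u - s)))" for \<omega>
  proof -
    have "(\<integral>\<^sup>+z. ennreal (normal_density 0 (sqrt (u - s)) z) * f (W \<omega>, z) \<partial>lborel)
      = (\<integral>\<^sup>+z. ennreal (L \<omega>) * (ennreal (normal_density 0 (sqrt (u - s)) z) *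
         ennreal (exp (G \<omega> * z - (G \<omega>)\<^sup>2 * (sqrt (u - s))\<^sup>2 / 2) * (A \<omega> + H \<omega> * (z - G \<omega> * (sqrt (u - s))\<^sup>2))\<^sup>2)) \<partial>lborel)"
      unfolding sq f_def W_def
      by (simp add: ennreal_mult' L ac_simps)
    also have "\<dots> = ennreal (L \<omega>) * ennreal ((A \<omega>)\<^sup>2 + (H \<omega>)\<^sup>2 * (sqrt (u - s))\<^sup>2)"
      by (subst nn_integral_cmult, simp) (subst nn_integral_tilted_normal_density[OF sq(2)], simp)
    finally show ?thesis using assms(2) L by (simp add: sq ennreal_mult')
  qed
  then show ?thesis
    using nn_integral_gaussian_increment[OF assms(1,2) \<open>W \<in> _\<close> \<open>f \<in> _\<close>]
    by (simp add: f_def W_def mult.assoc)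
qed

end

section \<open>Discrete stochastic exponentials\<close>

locale exponential_scheme = brownian_motion +
  fixes h :: real and G H :: "nat \<Rightarrow> 'a \<Rightarrow> real"
  assumes h: "0 < h"
    and G_measurable: "\<And>j. G j \<in> borel_measurable (F (j * h))"
    and H_measurable: "\<And>j. H j \<in> borel_measurable (F (j * h))"
begin

text \<open>The discrete stochastic exponential \<open>E\<close> of \<open>\<integral> G dB\<close>, and the martingale part \<open>A\<close> of \<open>\<integral> H dB\<close>
  under the measure with density \<open>E\<close>, with quadratic variation \<open>V\<close>.\<close>

definition D :: "nat \<Rightarrow> 'a \<Rightarrow> real" where
  "D j \<omega> = B (Suc j * h) \<omega> - B (j * h) \<omega>"

definition E :: "nat \<Rightarrow> 'a \<Rightarrow> real" where
  "E k \<omega> = exp (\<Sum>j<k. G j \<omega> * D j \<omega> - (G j \<omega>)\<^sup>2 * h / 2)"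

definition A :: "nat \<Rightarrow> 'a \<Rightarrow> real" where
  "A k \<omega> = (\<Sum>j<k. H j \<omega> * (D j \<omega> - G j \<omega> * h))"

definition V :: "nat \<Rightarrow> 'a \<Rightarrow> real" where
  "V k \<omega> = (\<Sum>j<k. (H j \<omega>)\<^sup>2 * h)"

lemma G_le: "j \<le> k \<Longrightarrow> G j \<in> borel_measurable (F (k * h))"
  using h by (intro measurable_F_le[OF G_measurable]) (simp add: mult_right_mono)

lemma H_le: "j \<le> k \<Longrightarrow> H j \<in> borel_measurable (F (k * h))"
  using h by (intro measurable_F_le[OF H_measurable]) (simp add: mult_right_mono)

lemma D_le: "j < (k :: nat) \<Longrightarrow> D j \<in> borel_measurable (F (k * h))"
  unfolding D_def using h
  by (intro borel_measurable_diff adapted_le mult_right_mono mult_nonneg_nonneg) auto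

lemma E_measurable: "E k \<in> borel_measurable (F (k * h))"
  unfolding E_def
  by (intro borel_measurable_exp measurable_compose[OF _ borel_measurable_exp] borel_measurable_sum borel_measurable_diff borel_measurable_times
      borel_measurable_divide borel_measurable_power borel_measurable_const G_le D_le) auto

lemma A_measurable: "A k \<in> borel_measurable (F (k * h))"
  unfolding A_def
  by (intro borel_measurable_sum borel_measurable_diff borel_measurable_times
      borel_measurable_const H_le G_le D_le) auto

text \<open>Predictability: the last summand involves only \<open>H k\<close>. In the isometry below
  this allows the weight \<open>E k\<close> to be replaced by \<open>E (Suc k)\<close> in front of
  \<open>V (Suc k)\<close>.\<close>

lemma V_measurable: "V (Suc k) \<in> borel_measurable (F (k * h))"
  unfolding V_def
  by (intro borel_measurable_sum borel_measurable_diff borel_measurable_times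
      borel_measurable_power borel_measurable_const H_le G_le D_le) auto

lemma V_measurable': "V k \<in> borel_measurable (F (k * h))"
proof (cases k)
  case (Suc i)
  then show ?thesis using h by (auto intro!: measurable_F_le[OF V_measurable] mult_right_mono)
qed (simp add: V_def[abs_def])

lemma E_pos: "0 < E k \<omega>" by (simp add: E_def)
lemma V_nonneg: "0 \<le> V k \<omega>" using h by (simp add: V_def sum_nonneg)

lemma V_mono: "k \<le> l \<Longrightarrow> V k \<omega> \<le> V l \<omega>"
  unfolding V_def using h by (intro sum_mono2) auto

lemma E_Suc: "E (Suc k) \<omega> = E k \<omega> * exp (G k \<omega> * D k \<omega> - (G k \<omega>)\<^sup>2 * h / 2)"
  by (simp add: E_def exp_add[symmetric])

text \<open>The common source of two facts: Y = 1, Z = 0 gives the martingale property of E, and Y =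
  \<open>A k\<close>, Z = \<open>H k\<close> gives one step of the isometry.\<close>

lemma nn_integral_step:
  assumes "W \<in> borel_measurable (F (k * h))" "Y \<in> borel_measurable (F (k * h))"
    "Z \<in> borel_measurable (F (k * h))" and "\<And>\<omega>. 0 \<le> W \<omega>"
  shows "(\<integral>\<^sup>+\<omega>. ennreal (W \<omega> * E (Suc k) \<omega> * (Y \<omega> + Z \<omega> * (D k \<omega> - G k \<omega> * h))\<^sup>2) \<partial>M)
       = (\<integral>\<^sup>+\<omega>. ennreal (W \<omega> * E k \<omega> * ((Y \<omega>)\<^sup>2 + (Z \<omega>)\<^sup>2 * h)) \<partial>M)"
proof -
  have s: "0 \<le> k * h" "k * h < Suc k * h" and d: "Suc k * h - k * h = h"
    using h by (auto simp: algebra_simps)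
  note WE = borel_measurable_times[OF assms(1) E_measurable]
  have pos: "0 \<le> W \<omega> * E k \<omega>" for \<omega> using assms(4) E_pos[of k \<omega>] by (simp add: less_imp_le)
  show ?thesis
    using nn_integral_tilted_increment[OF s WE assms(2) G_measurable assms(3) pos, unfolded d]
    by (simp add: E_Suc D_def mult.assoc)
qed

lemma nn_integral_E_weight:
  assumes W: "W \<in> borel_measurable (F (k * h))" and pos: "\<And>\<omega>. 0 \<le> W \<omega>" and "k \<le> l"
  shows "(\<integral>\<^sup>+\<omega>. ennreal (W \<omega> * E l \<omega>) \<partial>M) = (\<integral>\<^sup>+\<omega>. ennreal (W \<omega> * E k \<omega>) \<partial>M)"
  using \<open>k \<le> l\<close>
proof (induction l rule: dec_induct)
  case (step l)
  have "W \<in> borel_measurable (F (l * h))"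
    using h step by (intro measurable_F_le[OF W]) (simp add: mult_right_mono)
  from nn_integral_step[OF this borel_measurable_const[of 1] borel_measurable_const[of 0] pos] step
  show ?case by simp
qed simp

lemma nn_integral_E: "(\<integral>\<^sup>+\<omega>. ennreal (E k \<omega>) \<partial>M) = 1"
proof -
  have "(\<integral>\<^sup>+\<omega>. ennreal (1 * E k \<omega>) \<partial>M) = (\<integral>\<^sup>+\<omega>. ennreal (1 * E 0 \<omega>) \<partial>M)"
    by (intro nn_integral_E_weight) auto
  then show ?thesis by (simp add: E_def emeasure_space_1)
qed

text \<open>The Ito isometry under the measure with density \<open>E k\<close>.\<close>

lemma nn_integral_E_A2: "(\<integral>\<^sup>+\<omega>. ennreal (E k \<omega> * (A k \<omega>)\<^sup>2) \<partial>M) = (\<integral>\<^sup>+\<omega>. ennreal (E k \<omega> * V k \<omega>) \<partial>M)"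
proof (induction k)
  case 0
  then show ?case by (simp add: A_def V_def)
next
  case (Suc k)
  have [measurable]: "E k \<in> borel_measurable M" "A k \<in> borel_measurable M" "H k \<in> borel_measurable M"
     "V k \<in> borel_measurable M"
    by (rule measurable_F_M, rule E_measurable A_measurable H_measurable V_measurable')+
  have e: "0 \<le> E k \<omega>" for \<omega> using E_pos[of k \<omega>] by simp
  have "(\<integral>\<^sup>+\<omega>. ennreal (E (Suc k) \<omega> * (A (Suc k) \<omega>)\<^sup>2) \<partial>M)
      = (\<integral>\<^sup>+\<omega>. ennreal (E k \<omega> * ((A k \<omega>)\<^sup>2 + (H k \<omega>)\<^sup>2 * h)) \<partial>M)"
    using nn_integral_step[OF borel_measurable_const[of 1] A_measurable H_measurable, of k]
    by (simp add: A_def)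
  also have "\<dots> = (\<integral>\<^sup>+\<omega>. ennreal (E k \<omega> * (A k \<omega>)\<^sup>2) + ennreal (E k \<omega> * ((H k \<omega>)\<^sup>2 * h)) \<partial>M)"
    using h e by (intro nn_integral_cong) (simp add: distrib_left)
  also have "\<dots> = (\<integral>\<^sup>+\<omega>. ennreal (E k \<omega> * V k \<omega>) \<partial>M) + (\<integral>\<^sup>+\<omega>. ennreal (E k \<omega> * ((H k \<omega>)\<^sup>2 * h)) \<partial>M)"
    by (subst nn_integral_add) (simp_all add: Suc)
  also have "\<dots> = (\<integral>\<^sup>+\<omega>. ennreal (E k \<omega> * V k \<omega>) + ennreal (E k \<omega> * ((H k \<omega>)\<^sup>2 * h)) \<partial>M)"
    by (subst nn_integral_add) simp_all
  also have "\<dots> = (\<integral>\<^sup>+\<omega>. ennreal (V (Suc k) \<omega> * E k \<omega>) \<partial>M)"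
  proof (intro nn_integral_cong)
    fix \<omega>
    have "0 \<le> E k \<omega> * V k \<omega>" "0 \<le> E k \<omega> * ((H k \<omega>)\<^sup>2 * h)"
      using e V_nonneg h by (simp_all add: less_imp_le)
    moreover have "E k \<omega> * V k \<omega> + E k \<omega> * ((H k \<omega>)\<^sup>2 * h) = V (Suc k) \<omega> * E k \<omega>"
      by (simp add: V_def algebra_simps)
    ultimately show "ennreal (E k \<omega> * V k \<omega>) + ennreal (E k \<omega> * ((H k \<omega>)\<^sup>2 * h))
        = ennreal (V (Suc k) \<omega> * E k \<omega>)"
      by (metis ennreal_plus)
  qed
  also have "\<dots> = (\<integral>\<^sup>+\<omega>. ennreal (V (Suc k) \<omega> * E (Suc k) \<omega>) \<partial>M)"
    by (rule nn_integral_E_weight[symmetric]) (auto intro: V_measurable V_nonneg)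
  finally show ?case by (simp add: mult.commute)
qed

text \<open>The weight is moved back to time k, the isometry is applied there, and the weight is
  moved forward again. Keeping the single weight \<open>E l\<close> allows bounds for different k to
  be added later.\<close>

lemma nn_integral_E_A2_le:
  assumes "k \<le> l"
  shows "(\<integral>\<^sup>+\<omega>. ennreal (E l \<omega> * (A k \<omega>)\<^sup>2) \<partial>M) \<le> (\<integral>\<^sup>+\<omega>. ennreal (E l \<omega> * V l \<omega>) \<partial>M)"
proof -
  have "(\<integral>\<^sup>+\<omega>. ennreal ((A k \<omega>)\<^sup>2 * E l \<omega>) \<partial>M) = (\<integral>\<^sup>+\<omega>. ennreal ((A k \<omega>)\<^sup>2 * E k \<omega>) \<partial>M)"
    by (rule nn_integral_E_weight[OF borel_measurable_power[OF A_measurable] _ assms]) simp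
  also have "\<dots> = (\<integral>\<^sup>+\<omega>. ennreal (V k \<omega> * E k \<omega>) \<partial>M)"
    using nn_integral_E_A2[of k] by (simp add: mult.commute)
  also have "\<dots> = (\<integral>\<^sup>+\<omega>. ennreal (V k \<omega> * E l \<omega>) \<partial>M)"
    by (rule nn_integral_E_weight[OF V_measurable' _ assms, symmetric]) (simp add: V_nonneg)
  also have "\<dots> \<le> (\<integral>\<^sup>+\<omega>. ennreal (E l \<omega> * V l \<omega>) \<partial>M)"
    using V_mono[OF assms] E_pos[THEN less_imp_le, of l]
    by (intro nn_integral_mono ennreal_leI) (subst mult.commute, intro mult_left_mono)
  finally show ?thesis by (simp add: mult.commute)
qed

text \<open>The square of the exponential of G is the exponential of 2 G times
  \<open>exp (\<Sum> G\<^sup>2 h)\<close>; the first factor again has expectation 1, which is why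
  the scheme is interpreted a second time.\<close>

lemma nn_integral_E_square_le:
  assumes "\<And>\<omega>. (\<Sum>j<k. (G j \<omega>)\<^sup>2 * h) \<le> K"
  shows "(\<integral>\<^sup>+\<omega>. ennreal ((E k \<omega>)\<^sup>2) \<partial>M) \<le> ennreal (exp K)"
proof -
  interpret twice: exponential_scheme M F B h "\<lambda>j \<omega>. 2 * G j \<omega>" H
    by unfold_locales (intro h H_measurable borel_measurable_times borel_measurable_const G_measurable)+
  have eq: "(E k \<omega>)\<^sup>2 = twice.E k \<omega> * exp (\<Sum>j<k. (G j \<omega>)\<^sup>2 * h)" for \<omega>
  proof -
    have "2 * (\<Sum>j<k. G j \<omega> * D j \<omega> - (G j \<omega>)\<^sup>2 * h / 2)
        = (\<Sum>j<k. 2 * G j \<omega> * D j \<omega> - (2 * G j \<omega>)\<^sup>2 * h / 2) + (\<Sum>j<k. (G j \<omega>)\<^sup>2 * h)"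
      unfolding sum_distrib_left sum.distrib[symmetric]
      by (intro sum.cong refl) (simp add: power2_eq_square algebra_simps)
    then show ?thesis
      by (simp add: E_def twice.E_def twice.D_def D_def exp_add[symmetric] exp_double[symmetric])
  qed
  have "(E k \<omega>)\<^sup>2 \<le> exp K * twice.E k \<omega>" for \<omega>
    unfolding eq mult.commute[of "exp K"] using assms[of \<omega>] twice.E_pos[of k \<omega>]
    by (intro mult_left_mono) auto
  then have "(\<integral>\<^sup>+\<omega>. ennreal ((E k \<omega>)\<^sup>2) \<partial>M) \<le> (\<integral>\<^sup>+\<omega>. ennreal (exp K) * ennreal (twice.E k \<omega>) \<partial>M)"
    by (intro nn_integral_mono) (simp add: ennreal_mult'[symmetric] ennreal_leI)
  also have "\<dots> = ennreal (exp K)"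
    using measurable_F_M[OF twice.E_measurable] by (subst nn_integral_cmult) (auto simp: twice.nn_integral_E)
  finally show ?thesis .
qed

end

section \<open>The Riccati flow and path-by-path limits\<close>

text \<open>The test for index j includes \<open>a j\<close> itself, so the stopped sum cannot
  overshoot K. It omits at the first crossing one term of size at most b, which bounds the
  undershoot.\<close>

lemma sum_stopped:
  fixes a :: "nat \<Rightarrow> real"
  assumes a: "\<And>j. 0 \<le> a j" "\<And>j. a j \<le> b" and "0 \<le> K"
  shows "(\<Sum>j<N. if (\<Sum>i\<le>j. a i) \<le> K then a j else 0) \<le> K"
    and "K < (\<Sum>j<N. a j) \<Longrightarrow> K - b \<le> (\<Sum>j<N. if (\<Sum>i\<le>j. a i) \<le> K then a j else 0)"
proof -
  define V where "V n = (\<Sum>j<n. if (\<Sum>i\<le>j. a i) \<le> K then a j else 0)" for n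
  define S where "S n = (\<Sum>j<n. a j)" for n
  have "if S N \<le> K then V N = S N else K - b \<le> V N \<and> V N \<le> K"
  proof (induction N)
    case 0
    then show ?case using assms by (simp add: V_def S_def)
  next
    case (Suc N)
    have "V (Suc N) = V N + (if S (Suc N) \<le> K then a N else 0)" "S (Suc N) = S N + a N"
      by (simp_all only: V_def S_def sum.lessThan_Suc lessThan_Suc_atMost[symmetric])
    then show ?case using Suc a[of N] by (auto split: if_splits)
  qed
  then show "V N \<le> K" "K < (\<Sum>j<N. a j) \<Longrightarrow> K - b \<le> V N"
    by (auto simp: S_def[symmetric] split: if_splits)
qed

section \<open>The Riccati flow in closed form\<close>

text \<open>In this form signs are visible: (l + \<alpha>) exp (4 \<alpha> s) is at least l +
  \<alpha>, so the denominator is at least 2 \<alpha> and the sum in the numerator is at least 2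
  l.\<close>

lemma phi_eq:
  assumes "0 < \<alpha>" "0 \<le> l" "0 \<le> s"
  shows "phi \<alpha> s l = \<alpha> * ((l + \<alpha>) * exp (4 * \<alpha> * s) + (l - \<alpha>)) / ((l + \<alpha>) * exp (4 * \<alpha> * s) - (l - \<alpha>))"
    and "0 < (l + \<alpha>) * exp (4 * \<alpha> * s) - (l - \<alpha>)"
proof -
  have "l + \<alpha> \<le> (l + \<alpha>) * exp (4 * \<alpha> * s)"
    using assms mult_left_mono[of 1 "exp (4 * \<alpha> * s)" "l + \<alpha>"] by simp
  then show pos: "0 < (l + \<alpha>) * exp (4 * \<alpha> * s) - (l - \<alpha>)" using assms(1) by simp
  have eq: "2 * \<alpha> * exp (4 * \<alpha> * s) - (l - \<alpha>) * (1 - exp (4 * \<alpha> * s)) = (l + \<alpha>) * exp (4 * \<alpha> * s) - (l - \<alpha>)"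
    by (simp add: algebra_simps)
  have "1 + 2 * (l - \<alpha>) / ((l + \<alpha>) * exp (4 * \<alpha> * s) - (l - \<alpha>))
     = ((l + \<alpha>) * exp (4 * \<alpha> * s) + (l - \<alpha>)) / ((l + \<alpha>) * exp (4 * \<alpha> * s) - (l - \<alpha>))"
    using pos by (simp add: add_divide_eq_iff)
  then show "phi \<alpha> s l = \<alpha> * ((l + \<alpha>) * exp (4 * \<alpha> * s) + (l - \<alpha>)) / ((l + \<alpha>) * exp (4 * \<alpha> * s) - (l - \<alpha>))"
    unfolding phi_def eq by simp
qed

lemma phi_nonneg:
  assumes "0 < \<alpha>" "0 \<le> l" "0 \<le> s"
  shows "0 \<le> phi \<alpha> s l"
proof -
  have "l + \<alpha> \<le> (l + \<alpha>) * exp (4 * \<alpha> * s)"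
    using assms mult_left_mono[of 1 "exp (4 * \<alpha> * s)" "l + \<alpha>"] by simp
  then have "0 \<le> (l + \<alpha>) * exp (4 * \<alpha> * s) + (l - \<alpha>)" using assms(2) by simp
  then show ?thesis
    using phi_eq[OF assms] assms(1) by (simp del: times_divide_eq_right)
qed

lemma phi_0: "0 < \<alpha> \<Longrightarrow> phi \<alpha> 0 l = l"
  by (simp add: phi_def diff_divide_distrib)

text \<open>Since 2 \<alpha>^2 = \<gamma>, this is the equation for y run backwards in time.\<close>

lemma phi_has_derivative:
  assumes "0 < \<alpha>" "0 \<le> l" "0 \<le> s"
  shows "((\<lambda>s. phi \<alpha> s l) has_real_derivative 2 * \<alpha>\<^sup>2 - 2 * (phi \<alpha> s l)\<^sup>2) (at s)"
proof -
  define e where "e = exp (4 * \<alpha> * s)"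
  define q where "q = (l + \<alpha>) * e - (l - \<alpha>)"
  have q: "0 < q" using phi_eq(2)[OF assms] by (simp add: q_def e_def)
  have den: "2 * \<alpha> * exp (4 * \<alpha> * s) - (l - \<alpha>) * (1 - exp (4 * \<alpha> * s)) = q"
    by (simp add: q_def e_def algebra_simps)
  have "((\<lambda>s. phi \<alpha> s l) has_real_derivative
      \<alpha> * (- (2 * (l - \<alpha>) * (2 * \<alpha> * (4 * \<alpha> * e) + (l - \<alpha>) * (4 * \<alpha> * e))) / (q * q))) (at s)"
    unfolding phi_def
    by (rule derivative_eq_intros refl | use q den in \<open>simp add: e_def\<close>)+
  moreover have "\<alpha> * (- (2 * (l - \<alpha>) * (2 * \<alpha> * (4 * \<alpha> * e) + (l - \<alpha>) * (4 * \<alpha> * e))) / (q * q))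
     = 2 * \<alpha>\<^sup>2 - 2 * (phi \<alpha> s l)\<^sup>2"
  proof -
    have "phi \<alpha> s l = \<alpha> * ((l + \<alpha>) * e + (l - \<alpha>)) / q"
      using phi_eq(1)[OF assms] by (simp add: q_def e_def)
    then have "2 * \<alpha>\<^sup>2 - 2 * (phi \<alpha> s l)\<^sup>2 = (2 * \<alpha>\<^sup>2 * q\<^sup>2 - 2 * (\<alpha> * ((l + \<alpha>) * e + (l - \<alpha>)))\<^sup>2) / (q * q)"
      using q by (simp add: power2_eq_square diff_divide_distrib)
    also have "2 * \<alpha>\<^sup>2 * q\<^sup>2 - 2 * (\<alpha> * ((l + \<alpha>) * e + (l - \<alpha>)))\<^sup>2
      = \<alpha> * (- (2 * (l - \<alpha>) * (2 * \<alpha> * (4 * \<alpha> * e) + (l - \<alpha>) * (4 * \<alpha> * e))))"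
      by (simp add: q_def power2_eq_square algebra_simps)
    finally show ?thesis by simp
  qed
  ultimately show ?thesis by simp
qed

text \<open>Flow property: starting at the value reached from l after time t and undoing time u
  leaves time t - u. It is checked on the closed forms; p and r are the positive denominators that
  exclude division by zero.\<close>

lemma y_flow_phi:
  assumes "0 < \<alpha>" "0 \<le> l" "0 \<le> u" "u \<le> t"
  shows "y_flow \<alpha> (phi \<alpha> t l) u = phi \<alpha> (t - u) l"
proof -
  define E Eu where "E = exp (4 * \<alpha> * t)" and "Eu = exp (4 * \<alpha> * u)"
  define p where "p = (l + \<alpha>) * E - (l - \<alpha>)"
  define r where "r = (l + \<alpha>) * E - (l - \<alpha>) * Eu"
  have Eu: "0 < Eu" by (simp add: Eu_def)
  have Etu: "exp (4 * \<alpha> * (t - u)) = E / Eu"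
    by (simp add: E_def Eu_def exp_diff[symmetric] right_diff_distrib)
  have p: "0 < p" using phi_eq(2)[OF assms(1,2), of t] assms by (simp add: p_def E_def)
  have "0 < (l + \<alpha>) * (E / Eu) - (l - \<alpha>)"
    using phi_eq(2)[OF assms(1,2), of "t - u"] assms by (simp add: Etu)
  then have "0 < ((l + \<alpha>) * (E / Eu) - (l - \<alpha>)) * Eu" using Eu by simp
  also have "((l + \<alpha>) * (E / Eu) - (l - \<alpha>)) * Eu = r" using Eu by (simp add: r_def left_diff_distrib)
  finally have r: "0 < r" .
  have x0: "phi \<alpha> t l - \<alpha> = \<alpha> * (2 * (l - \<alpha>)) / p"
  proof -
    have "phi \<alpha> t l = \<alpha> * (p + 2 * (l - \<alpha>)) / p"
      using phi_eq(1)[OF assms(1,2), of t] assms by (simp add: p_def E_def)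
    also have "\<dots> = \<alpha> + \<alpha> * (2 * (l - \<alpha>)) / p"
      unfolding distrib_left add_divide_distrib using p by simp
    finally show ?thesis by simp
  qed
  have "2 * \<alpha> + (phi \<alpha> t l - \<alpha>) * (1 - Eu) = 2 * \<alpha> * r / p"
    unfolding x0 using p by (simp add: field_simps) (simp add: p_def r_def algebra_simps)
  then have "y_flow \<alpha> (phi \<alpha> t l) u = \<alpha> * (1 + 2 * (\<alpha> * (2 * (l - \<alpha>)) / p) * Eu / (2 * \<alpha> * r / p))"
    by (simp add: y_flow_def x0 Eu_def)
  also have "2 * (\<alpha> * (2 * (l - \<alpha>)) / p) * Eu / (2 * \<alpha> * r / p) = 2 * (l - \<alpha>) * Eu / r"
    using p r assms(1) by (simp add: field_simps)
  also have "\<alpha> * (1 + 2 * (l - \<alpha>) * Eu / r) = phi \<alpha> (t - u) l"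
  proof -
    have "phi \<alpha> (t - u) l = \<alpha> * ((l + \<alpha>) * (E / Eu) + (l - \<alpha>)) / ((l + \<alpha>) * (E / Eu) - (l - \<alpha>))"
      using phi_eq(1)[OF assms(1,2), of "t - u"] assms by (simp add: Etu)
    also have "(l + \<alpha>) * (E / Eu) + (l - \<alpha>) = ((l + \<alpha>) * E + (l - \<alpha>) * Eu) / Eu"
      using Eu by (simp add: field_simps)
    also have "(l + \<alpha>) * (E / Eu) - (l - \<alpha>) = r / Eu"
      using Eu by (simp add: r_def field_simps)
    also have "\<alpha> * (((l + \<alpha>) * E + (l - \<alpha>) * Eu) / Eu) / (r / Eu) = \<alpha> * ((r + 2 * (l - \<alpha>) * Eu) / r)"
      using Eu r by (simp add: r_def)
    finally show ?thesis using r by (simp add: add_divide_distrib)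
  qed
  finally show ?thesis .
qed

text \<open>A discretized integration by parts for \<open>y X\<close>: on a cell \<open>[a, b]\<close> the error is the increment
  of a function whose derivative is a continuous function of the three points \<open>s, a, b\<close> that
  vanishes on the diagonal because \<open>y' = 2 y\<^sup>2 - \<gamma>\<close>.\<close>

lemma riccati_sums_tendsto:
  fixes X \<Delta> y :: "real \<Rightarrow> real" and t \<gamma> :: real
  assumes t: "0 < t" and X: "continuous_on {0..t} X" and \<Delta>: "continuous_on {0..t} \<Delta>"
    and y: "\<And>s. s \<in> {0..t} \<Longrightarrow> (y has_real_derivative 2 * (y s)\<^sup>2 - \<gamma>) (at s within {0..t})"
  shows "(\<lambda>m. \<Sum>k<m. - y (k * (t / m)) * (X (Suc k * (t / m)) - X (k * (t / m))
               - (integral {0..Suc k * (t / m)} \<Delta> - integral {0..k * (t / m)} \<Delta>))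
             - 2 * (y (k * (t / m)))\<^sup>2 * X (k * (t / m)) * (t / m))
         \<longlonglongrightarrow> y 0 * X 0 - y t * X t - \<gamma> * integral {0..t} X + integral {0..t} (\<lambda>s. \<Delta> s * y s)"
    (is "?J \<longlonglongrightarrow> ?Z")
proof -
  define I P Q where "I s = integral {0..s} \<Delta>" and "P s = integral {0..s} X"
    and "Q s = integral {0..s} (\<lambda>s. \<Delta> s * y s)" for s
  define g where "g = (\<lambda>(s, a, b). (2 * (y s)\<^sup>2 - \<gamma>) * X b + y a * \<Delta> s - 2 * (y a)\<^sup>2 * X a + \<gamma> * X s - \<Delta> s * y s)"
  let ?C = "{0..t} \<times> {0..t} \<times> {0..t}"
  have yc: "continuous_on {0..t} y"
    using y by (meson DERIV_continuous continuous_on_eq_continuous_within)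
  have deriv: "((\<lambda>s. integral {0..s} f) has_real_derivative f s) (at s within {0..t})"
    if "continuous_on {0..t} f" "s \<in> {0..t}" for f s
    using integral_has_real_derivative[OF that] .
  have comp: "continuous_on ?C (\<lambda>p. f (fst p))" "continuous_on ?C (\<lambda>p. f (fst (snd p)))"
    "continuous_on ?C (\<lambda>p. f (snd (snd p)))" if "continuous_on {0..t} f" for f :: "real \<Rightarrow> real"
    by (rule continuous_on_compose2[OF that], (intro continuous_intros)[1], auto)+
  have "continuous_on ?C g"
    unfolding g_def split_beta by (intro continuous_intros comp X \<Delta> yc)
  then have unif: "uniformly_continuous_on ?C g"
    by (intro compact_uniformly_continuous compact_Times) auto
  show ?thesis
  proof (rule LIMSEQ_I)
    fix e :: real assume e: "0 < e"
    define e' where "e' = e / (2 * t)"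
    have e': "0 < e'" "e' * t < e" using e t by (simp_all add: e'_def)
    from unif e'(1) obtain d where d: "0 < d" and
      dd: "\<And>p q. p \<in> ?C \<Longrightarrow> q \<in> ?C \<Longrightarrow> dist q p < d \<Longrightarrow> dist (g q) (g p) < e'"
      unfolding uniformly_continuous_on_def by metis
    obtain m0 :: nat where m0: "2 * t / d < m0" using reals_Archimedean2 by blast
    have "norm (?J m - ?Z) < e" if m: "m0 \<le> m" for m
    proof -
      have m_pos: "0 < real m" using m0 m t d by (metis divide_pos_pos less_le_trans mult_pos_pos of_nat_le_iff order_less_trans zero_less_numeral)
      define w where "w = t / m"
      have w: "0 < w" "m * w = t" using m_pos t by (simp_all add: w_def)
      have "2 * t / d < m" using m0 m by linarith
      then have wd: "2 * w < d" using m_pos d by (simp add: w_def field_simps)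
      define a where "a k = k * w" for k :: nat
      have ab: "a k \<in> {0..t}" if "k \<le> m" for k
        using that w by (auto simp: a_def mult_right_mono w(2)[symmetric])
      \<comment> \<open>X is merely continuous, so summation by parts leaves it frozen at the end
        points of the cell; only y and the integrals are differentiated in s.\<close>
      define f where "f k s = y s * X (a (Suc k)) + y (a k) * I s - 2 * (y (a k))\<^sup>2 * X (a k) * s
          + \<gamma> * P s - Q s" for k s
      have cell: "\<bar>f k (a (Suc k)) - f k (a k)\<bar> \<le> e' * w" if k: "k < m" for k
      proof -
        have sub: "{a k..a (Suc k)} \<subseteq> {0..t}" using ab[of k] ab[of "Suc k"] k by auto
        have le: "a k \<le> a (Suc k)" using w by (simp add: a_def distrib_right)
        have "norm (f k (a (Suc k)) - f k (a k)) \<le> e' * norm (a (Suc k) - a k)"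
        proof (rule field_differentiable_bound[of "{a k..a (Suc k)}" "f k" "\<lambda>s. g (s, a k, a (Suc k))"])
          fix s assume s: "s \<in> {a k..a (Suc k)}"
          then have st: "s \<in> {0..t}" using sub by auto
          have "(f k has_real_derivative g (s, a k, a (Suc k))) (at s within {0..t})"
            unfolding f_def I_def P_def Q_def g_def
            by (rule derivative_eq_intros y deriv st X \<Delta> yc continuous_intros refl | simp)+
          then show "(f k has_real_derivative g (s, a k, a (Suc k))) (at s within {a k..a (Suc k)})"
            by (rule DERIV_subset) (use sub in auto)
          have "dist (s, a k, a (Suc k)) (s, s, s) < d"
          proof -
            have "dist (s, a k, a (Suc k)) (s, s, s) \<le> dist (a k) s + dist (a (Suc k)) s"
              by (simp add: dist_Pair_Pair) (metis dist_Pair_Pair sqrt_sum_squares_le_sum zero_le_dist)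
            also have "\<dots> = w" using s by (simp add: dist_real_def a_def distrib_right)
            finally show ?thesis using wd w by simp
          qed
          then have "dist (g (s, a k, a (Suc k))) (g (s, s, s)) < e'"
            using st ab[of k] ab[of "Suc k"] k by (intro dd) auto
          moreover have "g (s, s, s) = 0" by (simp add: g_def algebra_simps)
          ultimately show "norm (g (s, a k, a (Suc k))) \<le> e'" by simp
        qed (use le in auto)
        then show ?thesis using le by (simp add: a_def distrib_right)
      qed
      have am: "a m = t" using w by (simp add: a_def)
      have J: "?J m = (\<Sum>k<m. - y (a k) * (X (a (Suc k)) - X (a k) - (I (a (Suc k)) - I (a k)))
          - 2 * (y (a k))\<^sup>2 * X (a k) * w)"
        by (simp add: a_def w_def I_def)
      have "?Z = (\<Sum>k<m. (- y (a (Suc k)) * X (a (Suc k)) - \<gamma> * P (a (Suc k)) + Q (a (Suc k)))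
           - (- y (a k) * X (a k) - \<gamma> * P (a k) + Q (a k)))"
        unfolding sum_lessThan_telescope[of "\<lambda>k. - y (a k) * X (a k) - \<gamma> * P (a k) + Q (a k)"] am
        by (simp add: a_def P_def Q_def)
      then have "?J m - ?Z = (\<Sum>k<m. f k (a (Suc k)) - f k (a k))"
        unfolding J
        by (simp only: sum_subtractf[symmetric]) (intro sum.cong refl, simp add: f_def a_def algebra_simps)
      also have "\<bar>\<dots>\<bar> \<le> (\<Sum>k<m. e' * w)"
        by (intro order.trans[OF sum_abs] sum_mono cell) simp
      also have "\<dots> = e' * t" using w by simp
      finally show ?thesis using e' by simp
    qed
    then show "\<exists>m0. \<forall>m\<ge>m0. norm (?J m - ?Z) < e" by blast
  qed
qed

text \<open>A continuous path is bounded on [0, t], so clipping at \<open>n m\<close> \<ge> m is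
  eventually inactive, and each fine time lies within t / m of its coarse node. The fine resolution
  is an arbitrary function of m because it will be dictated by convergence in probability.\<close>

lemma clipped_sums_tendsto_0:
  fixes X :: "real \<Rightarrow> real" and n :: "nat \<Rightarrow> nat"
  assumes t: "0 < t" and X: "continuous_on {0..t} X" and pos: "\<And>s. s \<in> {0..t} \<Longrightarrow> 0 \<le> X s"
    and n: "\<And>m. m \<le> n m"
  shows "(\<lambda>m. \<Sum>j<m * n m. t / (m * n m) *
      \<bar>4 * min (max (X (j * (t / (m * n m)))) 0) (n m) - 4 * X (n m * (j div n m) * (t / (m * n m)))\<bar>) \<longlonglongrightarrow> 0"
    (is "?S \<longlonglongrightarrow> 0")
proof (rule LIMSEQ_I)
  fix e :: real assume e: "0 < e"
  define e' where "e' = e / (8 * t)"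
  have e': "0 < e'" "4 * e' * t < e" using e t by (simp_all add: e'_def)
  have "uniformly_continuous_on {0..t} X" using X by (intro compact_uniformly_continuous) auto
  with e'(1) obtain d where d: "0 < d" and
    dd: "\<And>p q. p \<in> {0..t} \<Longrightarrow> q \<in> {0..t} \<Longrightarrow> dist q p < d \<Longrightarrow> dist (X q) (X p) < e'"
    unfolding uniformly_continuous_on_def by metis
  have "bounded (X ` {0..t})"
    using X by (intro compact_imp_bounded compact_continuous_image) auto
  then obtain b where b: "\<And>s. s \<in> {0..t} \<Longrightarrow> \<bar>X s\<bar> \<le> b"
    unfolding bounded_iff real_norm_def by blast
  obtain m0 :: nat where m0: "max (t / d) (max b 0) < m0" using reals_Archimedean2 by blast
  have "norm (?S m - 0) < e" if m: "m0 \<le> m" for m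
  proof -
    have mm: "t / d < m" "b < m" "0 < real m" using m0 m by linarith+
    have nm: "real m \<le> n m" "0 < n m" using n[of m] mm(3) by auto
    define h where "h = t / (m * n m)"
    have h: "0 < h" "real m * real (n m) * h = t" "n m * h = t / m"
      using mm nm t by (simp_all add: h_def)
    have "\<bar>4 * min (max (X (j * h)) 0) (n m) - 4 * X (n m * (j div n m) * h)\<bar> \<le> 4 * e'"
      if j: "j < m * n m" for j
    proof -
      have jj: "real j = real (n m) * real (j div n m) + real (j mod n m)"
        by (metis mult_div_mod_eq of_nat_add of_nat_mult)
      have "real j * h \<le> real (m * n m) * h"
        using j h by (intro mult_right_mono) (simp_all only: of_nat_le_iff less_imp_le)
      then have s1: "j * h \<in> {0..t}" using h by auto
      have "real (n m) * (j div n m) \<le> j"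
        using jj of_nat_0_le_iff[of "j mod n m", where 'a = real] by linarith
      then have "n m * (j div n m) * h \<le> j * h" using h by (intro mult_right_mono) auto
      then have s2: "n m * (j div n m) * h \<in> {0..t}"
        using s1 h(1) unfolding atLeastAtMost_iff by (metis order.trans less_imp_le mult_nonneg_nonneg of_nat_0_le_iff)
      have "j * h - n m * (j div n m) * h = (j mod n m) * h" unfolding jj by (simp add: algebra_simps)
      moreover have "(j mod n m) * h < n m * h" using h nm by (intro mult_strict_right_mono) auto
      moreover have "t / m < d" using mm d by (simp add: field_simps)
      ultimately have "dist (j * h) (n m * (j div n m) * h) < d"
        using h by (simp add: dist_real_def)
      from dd[OF s2 s1 this] have "\<bar>X (j * h) - X (n m * (j div n m) * h)\<bar> < e'"
        by (simp add: dist_real_def)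
      moreover have "min (max (X (j * h)) 0) (n m) = X (j * h)"
        using pos[OF s1] b[OF s1] mm nm by simp
      ultimately show ?thesis by simp
    qed
    then have "?S m \<le> (\<Sum>j<m * n m. h * (4 * e'))"
      unfolding h_def[symmetric] using h by (intro sum_mono mult_left_mono) auto
    also have "\<dots> = 4 * e' * t" using h by (simp add: mult_ac)
    finally have "?S m < e" using e' by simp
    moreover have "0 \<le> ?S m" using t by (intro sum_nonneg) auto
    ultimately show ?thesis by simp
  qed
  then show "\<exists>m0. \<forall>m\<ge>m0. norm (?S m - 0) < e" by blast
qed

section \<open>Discretization of the squared Bessel process\<close>

text \<open>No measurability of the sets is assumed: \<open>measure\<close> is 0 on a non-measurable
  set, which may therefore be replaced by the empty set. This suits the sets in
  \<open>approximates\<close>, which involve path integrals.\<close>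

lemma (in prob_space) measure_tendsto_0_if_AE_eventually:
  assumes "AE \<omega> in M. \<forall>\<^sub>F n in sequentially. \<omega> \<notin> A n"
  shows "(\<lambda>n. measure M (A n)) \<longlonglongrightarrow> 0"
proof -
  define A' where "A' n = (if A n \<in> sets M then A n else {})" for n
  have [measurable]: "A' n \<in> sets M" for n by (simp add: A'_def)
  have "(\<lambda>n. \<integral>\<omega>. indicator (A' n) \<omega> \<partial>M) \<longlonglongrightarrow> (\<integral>\<omega>. (0::real) \<partial>M)"
  proof (rule integral_dominated_convergence[where w = "\<lambda>_. 1"])
    show "AE \<omega> in M. (\<lambda>n. indicator (A' n) \<omega> :: real) \<longlonglongrightarrow> 0"
      using assms
    proof eventually_elim
      case (elim \<omega>)
      then have "\<forall>\<^sub>F n in sequentially. indicator (A' n) \<omega> = (0::real)"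
        by eventually_elim (auto simp: A'_def)
      then show ?case by (rule tendsto_eventually)
    qed
  qed auto
  moreover have "measure M (A n) = measure M (A' n)" for n
    by (simp add: A'_def measure_notin_sets)
  ultimately show ?thesis by simp
qed

lemma elementary_value_eq:
  assumes i: "i < n" and mono: "\<And>i j. i \<le> j \<Longrightarrow> \<tau> i \<le> \<tau> j" and s: "\<tau> i < s" "s \<le> \<tau> (Suc i)"
  shows "elementary_value (n, \<tau>, \<xi>) s \<omega> = \<xi> i \<omega>"
proof -
  have ind: "indicator {\<tau> j<..\<tau> (Suc j)} s = (if j = i then 1 else 0 :: real)" for j
  proof (cases j i rule: linorder_cases)
    case less
    then show ?thesis using mono[of "Suc j" i] s by (auto simp: indicator_def)
  next
    case greater
    then show ?thesis using mono[of "Suc i" j] s by (auto simp: indicator_def)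
  qed (use s in auto)
  have "elementary_value (n, \<tau>, \<xi>) s \<omega> = (\<Sum>j<n. if j = i then \<xi> j \<omega> else 0)"
    unfolding elementary_value_def prod.case ind by (intro sum.cong) auto
  then show ?thesis using i by simp
qed

lemma progressive_measurable:
  assumes "progressive F X" "0 \<le> s"
  shows "X s \<in> borel_measurable (F s)"
proof -
  have X: "(\<lambda>(s, \<omega>). X s \<omega>) \<in> borel_measurable (restrict_space borel {0..s} \<Otimes>\<^sub>M F s)"
    using assms by (simp add: progressive_def)
  have "(\<lambda>\<omega>. (s, \<omega>)) \<in> F s \<rightarrow>\<^sub>M restrict_space borel {0..s} \<Otimes>\<^sub>M F s"
    using assms(2) by (intro measurable_Pair1') (simp add: space_restrict_space)
  from measurable_compose[OF this X] show ?thesis by simp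
qed

lemma progressive_integral_measurable:
  assumes "progressive F X" "0 \<le> s"
  shows "(\<lambda>\<omega>. LBINT u:{0..s}. X u \<omega>) \<in> borel_measurable (F s)"
proof -
  interpret finite_measure "restrict_space lborel {0..s}"
    by (rule finite_measureI) (use assms(2) in \<open>simp add: emeasure_restrict_space space_restrict_space\<close>)
  have "sets (restrict_space lborel {0..s}) = sets (restrict_space borel {0..s})"
    by (intro sets_restrict_space_cong) simp
  then have "sets (F s \<Otimes>\<^sub>M restrict_space lborel {0..s}) = sets (F s \<Otimes>\<^sub>M restrict_space borel {0..s})"
    by (intro sets_pair_measure_cong) auto
  moreover have "(\<lambda>(\<omega>, u). X u \<omega>) \<in> borel_measurable (F s \<Otimes>\<^sub>M restrict_space borel {0..s})"
  proof -
    have "(\<lambda>(u, \<omega>). X u \<omega>) \<in> borel_measurable (restrict_space borel {0..s} \<Otimes>\<^sub>M F s)"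
      using assms by (simp add: progressive_def)
    from measurable_pair_swap[OF this] show ?thesis by (simp add: split_beta)
  qed
  ultimately have "(\<lambda>(\<omega>, u). X u \<omega>) \<in> borel_measurable (F s \<Otimes>\<^sub>M restrict_space lborel {0..s})"
    by (simp cong: measurable_cong_sets)
  then have "(\<lambda>\<omega>. \<integral>u. X u \<omega> \<partial>restrict_space lborel {0..s}) \<in> borel_measurable (F s)"
    by (rule borel_measurable_lebesgue_integral)
  then show ?thesis
    by (simp add: integral_restrict_space set_lebesgue_integral_def)
qed

lemma set_lebesgue_integral_continuous:
  fixes f :: "real \<Rightarrow> real"
  assumes "continuous_on {0..s} f"
  shows "(LBINT u:{0..s}. f u) = integral {0..s} f"
  using borel_integrable_atLeastAtMost'[OF assms] by (rule set_borel_integral_eq_integral)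

section \<open>Discretization errors on two nested grids\<close>

locale squared_bessel_process = brownian_motion M F B
  for M :: "'a measure" and F :: "real \<Rightarrow> 'a measure" and B :: "real \<Rightarrow> 'a \<Rightarrow> real" +
  fixes X :: "real \<Rightarrow> 'a \<Rightarrow> real" and \<Delta> :: "real \<Rightarrow> real" and l \<gamma> x t \<alpha> :: real
  assumes l: "0 \<le> l" and \<gamma>: "0 < \<gamma>" and x: "0 \<le> x"
    and \<Delta>_continuous: "continuous_on {0..} \<Delta>" and \<Delta>_nonneg: "\<And>u. 0 \<le> u \<Longrightarrow> 0 \<le> \<Delta> u"
    and bessel: "generalized_squared_bessel M F B \<Delta> x X"
    and \<alpha>_def: "\<alpha> = sqrt (\<gamma> / 2)"
    and t: "0 < t"
begin

definition y :: "real \<Rightarrow> real" where "y s = phi \<alpha> (t - s) l"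

definition drift :: "real \<Rightarrow> real" where "drift s = (LBINT u:{0..s}. \<Delta> u)"

text \<open>\<open>W\<close> is the stochastic exponent \<open>- \<integral> 2 y \<surd>X dB - \<integral> 2 y\<^sup>2 X ds\<close> after integration by parts;
  \<open>exp W\<close> is bounded and the theorem says that it has expectation \<open>1\<close>.\<close>

definition W :: "'a \<Rightarrow> real" where
  "W \<omega> = phi \<alpha> t l * x + psi \<alpha> \<Delta> t l - l * X t \<omega> - \<gamma> * (LBINT u:{0..t}. X u \<omega>)"

text \<open>The coarse grid has mesh \<open>t/m\<close>, the fine grid has \<open>n\<close> steps per coarse cell; \<open>n\<close> is also the level
  at which \<open>X\<close> is clipped. The coefficient \<open>y\<close> is frozen on coarse cells, since the
  definition of the Ito integral gives convergence only at fixed times.\<close>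

definition step :: "nat \<Rightarrow> nat \<Rightarrow> real" where "step m n = t / (real m * real n)"

definition \<xi> :: "nat \<Rightarrow> nat \<Rightarrow> nat \<Rightarrow> 'a \<Rightarrow> real" where
  "\<xi> m n j \<omega> = 2 * sqrt (min (max (X (j * step m n) \<omega>) 0) n)"

definition dB :: "nat \<Rightarrow> nat \<Rightarrow> nat \<Rightarrow> 'a \<Rightarrow> real" where
  "dB m n j \<omega> = B (Suc j * step m n) \<omega> - B (j * step m n) \<omega>"

text \<open>The argument of the unclipped X is the coarse node to the left of the fine time, where y
  is frozen as well.\<close>

definition err1 :: "nat \<Rightarrow> nat \<Rightarrow> 'a \<Rightarrow> real" where
  "err1 m n \<omega> = (\<Sum>j<m * n. step m n * \<bar>(\<xi> m n j \<omega>)\<^sup>2 - 4 * X (real n * real (j div n) * step m n) \<omega>\<bar>)"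

text \<open>By the equation for X, for positive m and n and k \<le> m this is almost surely the
  distance between the elementary and the Ito integral at the k-th coarse node.\<close>

definition err2 :: "nat \<Rightarrow> nat \<Rightarrow> nat \<Rightarrow> 'a \<Rightarrow> real" where
  "err2 m n k \<omega> = \<bar>x + (\<Sum>j<k * n. \<xi> m n j \<omega> * dB m n j \<omega>) + drift (k * (t / m)) - X (k * (t / m)) \<omega>\<bar>"

definition J :: "nat \<Rightarrow> 'a \<Rightarrow> real" where
  "J m \<omega> = (\<Sum>k<m. - y (k * (t / m)) * (X (Suc k * (t / m)) \<omega> - X (k * (t / m)) \<omega>
               - (drift (Suc k * (t / m)) - drift (k * (t / m))))
             - 2 * (y (k * (t / m)))\<^sup>2 * X (k * (t / m)) \<omega> * (t / m))"

text \<open>The threshold \<eta> / m for \<open>err2\<close> compensates for adding up the errors of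
  m coarse cells.\<close>

definition Bad :: "real \<Rightarrow> nat \<Rightarrow> nat \<Rightarrow> 'a set" where
  "Bad \<eta> m n = {\<omega> \<in> space M. \<eta> < err1 m n \<omega>} \<union> (\<Union>k\<le>m. {\<omega> \<in> space M. \<eta> / m < err2 m n k \<omega>})
     \<union> {\<omega> \<in> space M. \<eta> < \<bar>J m \<omega> - W \<omega>\<bar>}"

lemma X_progressive: "progressive F X"
  using bessel by (simp add: generalized_squared_bessel_def)

lemma X_measurable_F: "0 \<le> s \<Longrightarrow> X s \<in> borel_measurable (F s)"
  by (rule progressive_measurable[OF X_progressive])

lemma X_measurable[measurable]: "0 \<le> s \<Longrightarrow> X s \<in> borel_measurable M"
  by (rule measurable_F_M, rule X_measurable_F)

lemma B_measurable[measurable]: "0 \<le> s \<Longrightarrow> B s \<in> borel_measurable M"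
  by (rule measurable_F_M, rule adapted)

lemma AE_X: "AE \<omega> in M. continuous_on {0..} (\<lambda>s. X s \<omega>) \<and> (\<forall>s\<ge>0. 0 \<le> X s \<omega>) \<and> X 0 \<omega> = x"
  using bessel unfolding generalized_squared_bessel_def by auto

lemma step_nonneg: "0 \<le> step m n" using t by (simp add: step_def)

lemma \<xi>_measurable_F: "\<xi> m n j \<in> borel_measurable (F (j * step m n))"
proof -
  have [measurable]: "X (j * step m n) \<in> borel_measurable (F (j * step m n))"
    using step_nonneg by (intro X_measurable_F) simp
  show ?thesis unfolding \<xi>_def[abs_def] by measurable
qed

lemma \<xi>_measurable[measurable]: "\<xi> m n j \<in> borel_measurable M"
  by (rule measurable_F_M, rule \<xi>_measurable_F)

lemma dB_measurable[measurable]: "dB m n j \<in> borel_measurable M"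
  unfolding dB_def[abs_def] using step_nonneg
  by (intro borel_measurable_diff B_measurable) simp_all

lemma W_measurable[measurable]: "W \<in> borel_measurable M"
proof -
  have [measurable]: "(\<lambda>\<omega>. LBINT u:{0..t}. X u \<omega>) \<in> borel_measurable M"
    by (rule measurable_F_M, rule progressive_integral_measurable[OF X_progressive]) (use t in simp)
  show ?thesis unfolding W_def[abs_def] using t
    by (intro borel_measurable_diff borel_measurable_times borel_measurable_const X_measurable) auto
qed

lemma J_measurable[measurable]: "J m \<in> borel_measurable M"
  unfolding J_def[abs_def] using t
  by (intro borel_measurable_sum borel_measurable_diff borel_measurable_times borel_measurable_const
      borel_measurable_uminus X_measurable) auto

lemma err1_measurable[measurable]: "err1 m n \<in> borel_measurable M"
  unfolding err1_def[abs_def] using step_nonneg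
  by (intro borel_measurable_sum borel_measurable_diff borel_measurable_times borel_measurable_const
      borel_measurable_abs borel_measurable_power \<xi>_measurable X_measurable) auto

lemma err2_measurable[measurable]: "err2 m n k \<in> borel_measurable M"
  unfolding err2_def[abs_def] using t
  by (intro borel_measurable_sum borel_measurable_diff borel_measurable_times borel_measurable_const
      borel_measurable_abs borel_measurable_add \<xi>_measurable dB_measurable X_measurable) auto

lemma Bad_measurable[measurable]: "Bad \<eta> m n \<in> sets M"
proof -
  have [measurable]: "{\<omega> \<in> space M. \<eta> / m < err2 m n k \<omega>} \<in> sets M" for k by simp
  show ?thesis unfolding Bad_def by (intro sets.Un sets.finite_UN) simp_all
qed

section \<open>Elementary approximations of the Ito integral\<close>

text \<open>With step t / (m n), the m n n intervals reach up to time n t. The horizon thus grows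
  with n, as \<open>approximates\<close> requires convergence on every bounded interval; m stays
  fixed along the sequence.\<close>

definition S :: "nat \<Rightarrow> nat \<Rightarrow> 'a elementary" where
  "S m n = (m * n * n, \<lambda>j. real j * step m n, \<xi> m n)"

lemma elementary_S: "elementary M F (S m n)"
proof -
  have "\<forall>i<m * n * n. \<forall>\<omega>\<in>space M. \<bar>\<xi> m n i \<omega>\<bar> \<le> 2 * sqrt n"
    by (simp add: \<xi>_def)
  then show ?thesis
    unfolding elementary_def S_def prod.case
    using step_nonneg[of m n] \<xi>_measurable_F by (auto simp: distrib_right)
qed

lemma approximates_S:
  assumes m: "0 < m"
  shows "approximates M (S m) (\<lambda>s \<omega>. 2 * sqrt (X s \<omega>))"
  unfolding approximates_def
proof (intro allI impI measure_tendsto_0_if_AE_eventually)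
  fix T \<epsilon> :: real assume T: "0 \<le> T" and \<epsilon>: "0 < \<epsilon>"
  show "AE \<omega> in M. \<forall>\<^sub>F n in sequentially. \<omega> \<notin> {\<omega> \<in> space M. ennreal \<epsilon>
      < (\<integral>\<^sup>+s\<in>{0..T}. ennreal ((elementary_value (S m n) s \<omega> - 2 * sqrt (X s \<omega>))\<^sup>2) \<partial>lborel)}"
    using AE_X
  proof eventually_elim
    case (elim \<omega>)
    then have "continuous_on {0..} (\<lambda>s. X s \<omega>)" and pos: "\<And>s. 0 \<le> s \<Longrightarrow> 0 \<le> X s \<omega>"
      by blast+
    then have cont: "continuous_on {0..T} (\<lambda>s. X s \<omega>)"
      by (elim continuous_on_subset) auto
    \<comment> \<open>Dividing by T + 1 covers T = 0.\<close>
    define \<delta> where "\<delta> = sqrt (\<epsilon> / (T + 1))"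
    have "\<delta>\<^sup>2 * T = \<epsilon> * (T / (T + 1))" using T \<epsilon> by (simp add: \<delta>_def)
    also have "\<dots> \<le> \<epsilon> * 1" using T \<epsilon> by (intro mult_left_mono) auto
    finally have \<delta>: "0 < \<delta>" "\<delta>\<^sup>2 * T \<le> \<epsilon>" using T \<epsilon> by (simp_all add: \<delta>_def)
    have "uniformly_continuous_on {0..T} (\<lambda>s. 2 * sqrt (X s \<omega>))"
      by (intro compact_uniformly_continuous continuous_intros cont) simp
    with \<delta>(1) obtain d where d: "0 < d" and
      dd: "\<And>p q. p \<in> {0..T} \<Longrightarrow> q \<in> {0..T} \<Longrightarrow> dist q p < d \<Longrightarrow>
         dist (2 * sqrt (X q \<omega>)) (2 * sqrt (X p \<omega>)) < \<delta>"
      unfolding uniformly_continuous_on_def by metis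
    have "bounded ((\<lambda>s. X s \<omega>) ` {0..T})"
      using cont by (intro compact_imp_bounded compact_continuous_image) auto
    then obtain b where b: "\<And>s. s \<in> {0..T} \<Longrightarrow> \<bar>X s \<omega>\<bar> \<le> b"
      unfolding bounded_iff real_norm_def by blast
    \<comment> \<open>The three bounds make the mesh smaller than d, the horizon n t larger than T,
      and the clipping inactive.\<close>
    obtain n0 :: nat where n0: "max (max (t / d) (T / t)) (max b 0) < n0" using reals_Archimedean2 by blast
    have "(\<integral>\<^sup>+s\<in>{0..T}. ennreal ((elementary_value (S m n) s \<omega> - 2 * sqrt (X s \<omega>))\<^sup>2) \<partial>lborel) \<le> ennreal \<epsilon>"
      if n: "n0 \<le> n" for n
    proof -
      have nn: "t / d < n" "b < n" "0 < real n" "T / t < n" using n0 n by linarith+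
      define h where "h = step m n"
      have "m * n * h = t" using m nn by (simp add: h_def step_def)
      moreover have "0 < h" using m nn t by (simp add: h_def step_def)
      moreover have "h < d"
      proof -
        have "h \<le> t / n" unfolding h_def step_def using m nn t by (intro divide_left_mono) auto
        also have "\<dots> < d" using nn d by (simp add: field_simps)
        finally show ?thesis .
      qed
      ultimately have h: "m * n * h = t" "0 < h" "h < d" by auto
      have close: "\<bar>elementary_value (S m n) s \<omega> - 2 * sqrt (X s \<omega>)\<bar> \<le> \<delta>" if s: "0 < s" "s \<le> T" for s
      proof -
        define i where "i = nat (\<lceil>s / h\<rceil> - 1)"
        have "0 < s / h" using s h by simp
        then have "1 \<le> \<lceil>s / h\<rceil>" by linarith
        then have i: "real i = \<lceil>s / h\<rceil> - 1" by (simp add: i_def)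
        have "real i < s / h" "s / h \<le> Suc i" using i by linarith+
        then have ib: "i * h < s" "s \<le> Suc i * h" using h by (simp_all add: field_simps)
        have "T < n * t" using nn t by (simp add: field_simps)
        moreover have "real (m * n * n) * h = n * t"
          unfolding of_nat_mult h(1)[symmetric] by (simp add: mult_ac)
        ultimately have "i * h < real (m * n * n) * h" using ib s by linarith
        then have "i < m * n * n" using h(2) by (simp only: mult_less_cancel_right_pos of_nat_less_iff)
        then have "elementary_value (S m n) s \<omega> = \<xi> m n i \<omega>"
          unfolding S_def using ib h(2)
          by (intro elementary_value_eq) (auto simp: h_def[symmetric] intro: mult_right_mono)
        also have "\<dots> = 2 * sqrt (X (i * h) \<omega>)"
          using pos[of "i * h"] b[of "i * h"] ib s h nn by (simp add: \<xi>_def h_def[symmetric])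
        finally have "\<bar>elementary_value (S m n) s \<omega> - 2 * sqrt (X s \<omega>)\<bar>
            = dist (2 * sqrt (X (i * h) \<omega>)) (2 * sqrt (X s \<omega>))"
          by (simp add: dist_real_def)
        also have "\<dots> < \<delta>"
          using ib s h by (intro dd) (auto simp: dist_real_def distrib_right)
        finally show ?thesis by simp
      qed
      have "(\<integral>\<^sup>+s\<in>{0..T}. ennreal ((elementary_value (S m n) s \<omega> - 2 * sqrt (X s \<omega>))\<^sup>2) \<partial>lborel)
          \<le> (\<integral>\<^sup>+s\<in>{0..T}. ennreal (\<delta>\<^sup>2) \<partial>lborel)"
      proof (rule nn_integral_mono_AE)
        show "AE s in lborel. ennreal ((elementary_value (S m n) s \<omega> - 2 * sqrt (X s \<omega>))\<^sup>2) * indicator {0..T} s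
            \<le> ennreal (\<delta>\<^sup>2) * indicator {0..T} s"
          \<comment> \<open>The intervals are left-open, so the elementary process vanishes at time
            0 and that point is discarded.\<close>
          using AE_lborel_singleton[of 0]
        proof eventually_elim
          case (elim s)
          show ?case
          proof (cases "s \<in> {0..T}")
            case True
            then have "\<bar>elementary_value (S m n) s \<omega> - 2 * sqrt (X s \<omega>)\<bar> \<le> \<delta>"
              using elim by (intro close) auto
            then have "(elementary_value (S m n) s \<omega> - 2 * sqrt (X s \<omega>))\<^sup>2 \<le> \<delta>\<^sup>2"
              using \<delta>(1) by (subst abs_le_square_iff[symmetric]) simp
            then show ?thesis using True by (auto intro: ennreal_leI)
          qed simp
        qed
      qed
      also have "\<dots> = ennreal (\<delta>\<^sup>2 * T)"
        using T by (simp add: nn_integral_cmult_indicator ennreal_mult)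
      also have "\<dots> \<le> ennreal \<epsilon>" using \<delta> by (intro ennreal_leI)
      finally show ?thesis .
    qed
    then have "\<forall>n\<ge>n0. \<omega> \<notin> {\<omega> \<in> space M. ennreal \<epsilon>
      < (\<integral>\<^sup>+s\<in>{0..T}. ennreal ((elementary_value (S m n) s \<omega> - 2 * sqrt (X s \<omega>))\<^sup>2) \<partial>lborel)}"
      unfolding mem_Collect_eq not_less[symmetric] by blast
    then show ?case unfolding eventually_sequentially by blast
  qed
qed

text \<open>A coarse time is the fine grid point with index k n, so each \<open>min\<close> either
  keeps a whole increment or collapses it.\<close>

lemma elementary_integral_S:
  assumes "0 < m" "0 < n" "k \<le> m"
  shows "elementary_integral B (S m n) (k * (t / m)) \<omega> = (\<Sum>j<k * n. \<xi> m n j \<omega> * dB m n j \<omega>)"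
proof -
  define h where "h = step m n"
  have kt: "k * (t / m) = real (k * n) * h" using assms by (simp add: h_def step_def)
  have h: "0 \<le> h" using step_nonneg by (simp add: h_def)
  have "k * n * 1 \<le> m * n * n" using assms by (intro mult_le_mono) auto
  then have sub: "{..<k * n} \<subseteq> {..<m * n * n}" by auto
  have "elementary_integral B (S m n) (k * (t / m)) \<omega> =
     (\<Sum>j<m * n * n. \<xi> m n j \<omega> * (B (min (real (k * n) * h) (Suc j * h)) \<omega> - B (min (real (k * n) * h) (j * h)) \<omega>))"
    unfolding kt by (simp add: elementary_integral_def S_def h_def)
  also have "\<dots> = (\<Sum>j<k * n. \<xi> m n j \<omega> * (B (min (real (k * n) * h) (Suc j * h)) \<omega> - B (min (real (k * n) * h) (j * h)) \<omega>))"
  proof (intro sum.mono_neutral_right sub ballI)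
    fix j assume "j \<in> {..<m * n * n} - {..<k * n}"
    then have "real (k * n) * h \<le> real j * h" "real (k * n) * h \<le> real (Suc j) * h"
      using h by (auto intro!: mult_right_mono simp del: of_nat_mult of_nat_Suc)
    then show "\<xi> m n j \<omega> * (B (min (real (k * n) * h) (Suc j * h)) \<omega> - B (min (real (k * n) * h) (j * h)) \<omega>) = 0"
      by (simp add: min_absorb1 del: of_nat_mult of_nat_Suc)
  qed simp
  also have "\<dots> = (\<Sum>j<k * n. \<xi> m n j \<omega> * dB m n j \<omega>)"
  proof (intro sum.cong refl)
    fix j assume "j \<in> {..<k * n}"
    then have "real j * h \<le> real (k * n) * h" "real (Suc j) * h \<le> real (k * n) * h"
      using h by (auto intro!: mult_right_mono simp del: of_nat_mult of_nat_Suc)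
    then show "\<xi> m n j \<omega> * (B (min (real (k * n) * h) (Suc j * h)) \<omega> - B (min (real (k * n) * h) (j * h)) \<omega>)
       = \<xi> m n j \<omega> * dB m n j \<omega>"
      by (simp add: min_absorb2 dB_def h_def[symmetric] del: of_nat_mult of_nat_Suc)
  qed
  finally show ?thesis .
qed

text \<open>For fixed m only m + 1 times are involved, so convergence in probability at each of them
  and a union bound suffice. Adding the drift turns the error of the integral into
  \<open>err2\<close>.\<close>

lemma err2_tendsto_0:
  assumes m: "0 < m" and "0 < \<eta>"
  shows "(\<lambda>n. measure M (\<Union>k\<le>m. {\<omega> \<in> space M. \<eta> < err2 m n k \<omega>})) \<longlonglongrightarrow> 0"
proof -
  from bessel obtain I where I: "ito_integral M F B (\<lambda>t \<omega>. 2 * sqrt (X t \<omega>)) I"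
    and XI: "AE \<omega> in M. \<forall>t\<ge>0. X t \<omega> = x + I t \<omega> + (LBINT u:{0..t}. \<Delta> u)"
    unfolding generalized_squared_bessel_def by auto
  have conv: "(\<lambda>n. measure M {\<omega> \<in> space M. \<eta> < err2 m n k \<omega>}) \<longlonglongrightarrow> 0" if k: "k \<le> m" for k
  proof -
    let ?s = "k * (t / m)"
    have s: "0 \<le> ?s" using t by simp
    have "tendsto_in_prob M (\<lambda>n. elementary_integral B (S m n) ?s) (I ?s)"
      using I elementary_S approximates_S[OF m] s unfolding ito_integral_def by blast
    then have lim: "(\<lambda>n. measure M {\<omega> \<in> space M. \<eta> < \<bar>elementary_integral B (S m n) ?s \<omega> - I ?s \<omega>\<bar>}) \<longlonglongrightarrow> 0"
      using \<open>0 < \<eta>\<close> unfolding tendsto_in_prob_def by blast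
    have [measurable]: "I ?s \<in> borel_measurable M"
      using I s unfolding ito_integral_def by blast
    have "measure M {\<omega> \<in> space M. \<eta> < \<bar>elementary_integral B (S m n) ?s \<omega> - I ?s \<omega>\<bar>}
        = measure M {\<omega> \<in> space M. \<eta> < err2 m n k \<omega>}" if n: "1 \<le> n" for n
    proof (rule finite_measure_eq_AE)
      show "AE \<omega> in M. \<omega> \<in> {\<omega> \<in> space M. \<eta> < \<bar>elementary_integral B (S m n) ?s \<omega> - I ?s \<omega>\<bar>} \<longleftrightarrow>
           \<omega> \<in> {\<omega> \<in> space M. \<eta> < err2 m n k \<omega>}"
        using XI
      proof eventually_elim
        case (elim \<omega>)
        then have "X ?s \<omega> = x + I ?s \<omega> + drift ?s" using s unfolding drift_def by blast
        then show ?case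
          using elementary_integral_S[OF m _ k, of n \<omega>] n by (simp add: err2_def)
      qed
      show "{\<omega> \<in> space M. \<eta> < \<bar>elementary_integral B (S m n) ?s \<omega> - I ?s \<omega>\<bar>} \<in> sets M"
        using n by (subst elementary_integral_S[OF m _ k]) (simp, measurable)
    qed simp
    then have "\<forall>\<^sub>F n in sequentially. measure M {\<omega> \<in> space M. \<eta> < \<bar>elementary_integral B (S m n) ?s \<omega> - I ?s \<omega>\<bar>}
        = measure M {\<omega> \<in> space M. \<eta> < err2 m n k \<omega>}"
      by (auto simp: eventually_sequentially)
    with lim show ?thesis by (rule Lim_transform_eventually)
  qed
  then have "(\<lambda>n. \<Sum>k\<le>m. measure M {\<omega> \<in> space M. \<eta> < err2 m n k \<omega>}) \<longlonglongrightarrow> (\<Sum>k\<le>m. 0)"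
    by (intro tendsto_sum) auto
  then have lim: "(\<lambda>n. \<Sum>k\<le>m. measure M {\<omega> \<in> space M. \<eta> < err2 m n k \<omega>}) \<longlonglongrightarrow> 0" by simp
  show ?thesis
  proof (rule tendsto_sandwich[OF _ _ tendsto_const lim])
    show "\<forall>\<^sub>F n in sequentially. measure M (\<Union>k\<le>m. {\<omega> \<in> space M. \<eta> < err2 m n k \<omega>})
        \<le> (\<Sum>k\<le>m. measure M {\<omega> \<in> space M. \<eta> < err2 m n k \<omega>})"
      by (intro always_eventually allI measure_UNION_le) auto
  qed simp
qed

section \<open>Pathwise convergence and the choice of the grids\<close>

lemma \<alpha>: "0 < \<alpha>" "2 * \<alpha>\<^sup>2 = \<gamma>" using \<gamma> by (simp_all add: \<alpha>_def)

lemma y_has_derivative: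
  assumes "s \<in> {0..t}"
  shows "(y has_real_derivative 2 * (y s)\<^sup>2 - \<gamma>) (at s within A)"
proof -
  have "((\<lambda>s. phi \<alpha> s l) has_real_derivative \<gamma> - 2 * (y s)\<^sup>2) (at (t - s))"
    using phi_has_derivative[OF \<alpha>(1) l, of "t - s"] assms by (simp add: y_def \<alpha>(2))
  then have "((\<lambda>s. phi \<alpha> (t - s) l) has_real_derivative (\<gamma> - 2 * (y s)\<^sup>2) * - 1) (at s)"
    by (rule DERIV_chain2) (rule derivative_eq_intros refl | simp)+
  then show ?thesis
    unfolding y_def[abs_def, symmetric] by (simp add: has_field_derivative_at_within)
qed

lemma psi_eq: "psi \<alpha> \<Delta> t l = integral {0..t} (\<lambda>s. \<Delta> s * y s)"
proof -
  have "psi \<alpha> \<Delta> t l = (LBINT s:{0..t}. \<Delta> s * y s)"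
    unfolding psi_def y_def using y_flow_phi[OF \<alpha>(1) l]
    by (intro set_lebesgue_integral_cong) auto
  also have "\<dots> = integral {0..t} (\<lambda>s. \<Delta> s * y s)"
    using y_has_derivative by (intro set_lebesgue_integral_continuous continuous_intros
       continuous_on_subset[OF \<Delta>_continuous] DERIV_continuous_on) auto
  finally show ?thesis .
qed

lemma J_tendsto_W:
  assumes "continuous_on {0..} (\<lambda>s. X s \<omega>)" "X 0 \<omega> = x"
  shows "(\<lambda>m. J m \<omega>) \<longlonglongrightarrow> W \<omega>"
proof -
  have X: "continuous_on {0..t} (\<lambda>s. X s \<omega>)" using assms(1) by (rule continuous_on_subset) auto
  have \<Delta>: "continuous_on {0..t} \<Delta>" using \<Delta>_continuous by (rule continuous_on_subset) auto
  have drift: "drift s = integral {0..s} \<Delta>" for s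
    unfolding drift_def using \<Delta>_continuous
    by (intro set_lebesgue_integral_continuous) (rule continuous_on_subset, auto)
  have "W \<omega> = y 0 * X 0 \<omega> - y t * X t \<omega> - \<gamma> * integral {0..t} (\<lambda>s. X s \<omega>) + integral {0..t} (\<lambda>s. \<Delta> s * y s)"
    unfolding W_def psi_eq set_lebesgue_integral_continuous[OF X] using assms(2) phi_0[OF \<alpha>(1)]
    by (simp add: y_def)
  then show ?thesis
    using riccati_sums_tendsto[OF t X \<Delta> y_has_derivative] unfolding J_def drift by simp
qed

lemma err1_tendsto_0:
  assumes "continuous_on {0..} (\<lambda>s. X s \<omega>)" "\<forall>s\<ge>0. 0 \<le> X s \<omega>" "\<And>m. m \<le> n m"
  shows "(\<lambda>m. err1 m (n m) \<omega>) \<longlonglongrightarrow> 0"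
proof -
  have X: "continuous_on {0..t} (\<lambda>s. X s \<omega>)" using assms(1) by (rule continuous_on_subset) auto
  have \<xi>2: "(\<xi> m k j \<omega>)\<^sup>2 = 4 * min (max (X (j * step m k) \<omega>) 0) k" for m k j
    by (simp add: \<xi>_def power_mult_distrib)
  have pos: "0 \<le> X s \<omega>" if "s \<in> {0..t}" for s using assms(2) that by auto
  show ?thesis
    using clipped_sums_tendsto_0[where n = n, OF t X pos assms(3)]
    unfolding err1_def \<xi>2 unfolding step_def of_nat_mult .
qed

text \<open>A diagonal choice: for every m a fine resolution \<open>n m\<close> \<ge> m is fixed
  that makes \<open>err2\<close> small in probability; then m is taken large for \<open>err1\<close>
  and J, which converge almost surely along that sequence.\<close>

lemma Bad_small:
  assumes "0 < \<eta>" "0 < \<epsilon>"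
  obtains m n where "0 < m" "0 < n" "measure M (Bad \<eta> m n) < \<epsilon>"
proof -
  define p where "p m n = measure M (\<Union>k\<le>m. {\<omega> \<in> space M. \<eta> / m < err2 m n k \<omega>})" for m n
  have "\<exists>n. m \<le> n \<and> (0 < m \<longrightarrow> p m n < \<epsilon> / 3)" for m
  proof (cases "0 < m")
    case True
    then have "\<forall>\<^sub>F n in sequentially. p m n < \<epsilon> / 3"
      unfolding p_def using assms by (intro order_tendstoD(2)[OF err2_tendsto_0]) auto
    from eventually_happens'[OF sequentially_bot eventually_conj[OF eventually_ge_at_top[of m] this]]
    show ?thesis by blast
  qed auto
  then obtain n where "\<forall>m. m \<le> n m \<and> (0 < m \<longrightarrow> p m (n m) < \<epsilon> / 3)"
    using choice[of "\<lambda>m n. m \<le> n \<and> (0 < m \<longrightarrow> p m n < \<epsilon> / 3)"] by blast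
  then have n: "\<And>m. m \<le> n m" and n2: "\<And>m. 0 < m \<Longrightarrow> p m (n m) < \<epsilon> / 3"
    by blast+
  have "(\<lambda>m. measure M {\<omega> \<in> space M. \<eta> < err1 m (n m) \<omega>}) \<longlonglongrightarrow> 0"
  proof (rule measure_tendsto_0_if_AE_eventually)
    show "AE \<omega> in M. \<forall>\<^sub>F m in sequentially. \<omega> \<notin> {\<omega> \<in> space M. \<eta> < err1 m (n m) \<omega>}"
      using AE_X
    proof eventually_elim
      case (elim \<omega>)
      then have "\<forall>\<^sub>F m in sequentially. err1 m (n m) \<omega> < \<eta>"
        using assms(1) by (intro order_tendstoD(2)[OF err1_tendsto_0]) (auto intro: n)
      then show ?case by eventually_elim simp
    qed
  qed
  then have ev1: "\<forall>\<^sub>F m in sequentially. measure M {\<omega> \<in> space M. \<eta> < err1 m (n m) \<omega>} < \<epsilon> / 3"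
    using assms by (intro order_tendstoD(2)) auto
  have "(\<lambda>m. measure M {\<omega> \<in> space M. \<eta> < \<bar>J m \<omega> - W \<omega>\<bar>}) \<longlonglongrightarrow> 0"
  proof (rule measure_tendsto_0_if_AE_eventually)
    show "AE \<omega> in M. \<forall>\<^sub>F m in sequentially. \<omega> \<notin> {\<omega> \<in> space M. \<eta> < \<bar>J m \<omega> - W \<omega>\<bar>}"
      using AE_X
    proof eventually_elim
      case (elim \<omega>)
      then have "\<forall>\<^sub>F m in sequentially. dist (J m \<omega>) (W \<omega>) < \<eta>"
        using assms(1) by (intro tendstoD[OF J_tendsto_W]) auto
      then show ?case by eventually_elim (simp add: dist_real_def)
    qed
  qed
  then have ev3: "\<forall>\<^sub>F m in sequentially. measure M {\<omega> \<in> space M. \<eta> < \<bar>J m \<omega> - W \<omega>\<bar>} < \<epsilon> / 3"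
    using assms by (intro order_tendstoD(2)) auto
  from eventually_happens'[OF _ eventually_conj[OF eventually_gt_at_top[of 0] eventually_conj[OF ev1 ev3]]]
  obtain m :: nat where m: "0 < m" and m1: "measure M {\<omega> \<in> space M. \<eta> < err1 m (n m) \<omega>} < \<epsilon> / 3"
    and m3: "measure M {\<omega> \<in> space M. \<eta> < \<bar>J m \<omega> - W \<omega>\<bar>} < \<epsilon> / 3" by auto
  have "measure M (Bad \<eta> m (n m)) \<le> (measure M {\<omega> \<in> space M. \<eta> < err1 m (n m) \<omega>}
      + p m (n m))
      + measure M {\<omega> \<in> space M. \<eta> < \<bar>J m \<omega> - W \<omega>\<bar>}"
    unfolding Bad_def p_def
    by (rule order.trans[OF measure_Un_le add_right_mono[OF measure_Un_le]])
      (auto intro!: sets.Un sets.finite_UN)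
  also have "\<dots> < \<epsilon>" using m1 n2[OF m] m3 by simp
  finally show thesis using that[of m "n m"] m n[of m] by simp
qed

section \<open>Stopping at a bounded quadratic variation\<close>

text \<open>Up to the last grid point before the discrete quadratic variation exceeds \<open>K\<close>, \<open>H\<close> is \<open>\<xi>\<close>.
  Since that variation is predictable, the sum of the \<open>H\<^sup>2 h\<close> never exceeds \<open>K\<close>.\<close>

definition H :: "nat \<Rightarrow> nat \<Rightarrow> real \<Rightarrow> nat \<Rightarrow> 'a \<Rightarrow> real" where
  "H m n K j \<omega> = (if (\<Sum>i\<le>j. (\<xi> m n i \<omega>)\<^sup>2 * step m n) \<le> K then \<xi> m n j \<omega> else 0)"

definition node :: "nat \<Rightarrow> nat \<Rightarrow> nat \<Rightarrow> real" where
  "node m n j = real n * real (j div n) * step m n"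

definition G :: "nat \<Rightarrow> nat \<Rightarrow> real \<Rightarrow> nat \<Rightarrow> 'a \<Rightarrow> real" where
  "G m n K j \<omega> = - y (node m n j) * H m n K j \<omega>"

lemma y_nonneg: "s \<in> {0..t} \<Longrightarrow> 0 \<le> y s"
  unfolding y_def by (intro phi_nonneg \<alpha> l) auto

lemma y_bounded: obtains C where "0 < C" "\<And>s. s \<in> {0..t} \<Longrightarrow> y s \<le> C"
proof -
  have "continuous_on {0..t} y" by (rule DERIV_continuous_on, rule y_has_derivative)
  then have "bounded (y ` {0..t})" by (intro compact_imp_bounded compact_continuous_image) auto
  then obtain b where "\<And>s. s \<in> {0..t} \<Longrightarrow> \<bar>y s\<bar> \<le> b"
    unfolding bounded_iff real_norm_def by blast
  then show thesis by (intro that[of "max b 1"]) fastforce+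
qed

lemma drift_mono:
  assumes "0 \<le> s" "s \<le> u"
  shows "drift s \<le> drift u"
proof -
  have cont: "continuous_on {0..v} \<Delta>" for v by (rule continuous_on_subset[OF \<Delta>_continuous]) auto
  have "integral {0..s} \<Delta> \<le> integral {0..u} \<Delta>"
    using assms \<Delta>_nonneg by (intro integral_subset_le integrable_continuous_real cont) auto
  then show ?thesis by (simp add: drift_def set_lebesgue_integral_continuous[OF cont])
qed

lemma drift_nonneg: "0 \<le> drift t"
  using drift_mono[of 0 t] t by (simp add: drift_def set_integral_at_point)

lemma step_pos: "0 < m \<Longrightarrow> 0 < n \<Longrightarrow> 0 < step m n"
  using t by (simp add: step_def)

lemma exponential_scheme:
  assumes "0 < m" "0 < n"
  shows "exponential_scheme M F B (step m n) (G m n K) (H m n K)"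
proof -
  have H: "H m n K j \<in> borel_measurable (F (j * step m n))" for j
  proof -
    have [measurable]: "\<xi> m n i \<in> borel_measurable (F (j * step m n))" if "i \<le> j" for i
      using that step_nonneg[of m n] by (intro measurable_F_le[OF \<xi>_measurable_F] mult_right_mono) auto
    have "(\<lambda>\<omega>. \<Sum>i\<le>j. (\<xi> m n i \<omega>)\<^sup>2 * step m n) \<in> borel_measurable (F (j * step m n))"
      by (intro borel_measurable_sum borel_measurable_times borel_measurable_power borel_measurable_const) auto
    then have "{\<omega> \<in> space (F (j * step m n)). (\<Sum>i\<le>j. (\<xi> m n i \<omega>)\<^sup>2 * step m n) \<le> K} \<in> sets (F (j * step m n))"
      by (intro borel_measurable_le) auto
    then show ?thesis unfolding H_def[abs_def] by (intro measurable_If) auto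
  qed
  show ?thesis
  proof unfold_locales
    show "G m n K j \<in> borel_measurable (F (j * step m n))" for j
      unfolding G_def[abs_def] by (intro borel_measurable_times borel_measurable_const H)
  qed (use H step_pos[OF assms] in auto)
qed

end

section \<open>Estimates outside the bad event\<close>

locale discretized_bessel = squared_bessel_process M F B X \<Delta> l \<gamma> x t \<alpha>
  for M :: "'a measure" and F :: "real \<Rightarrow> 'a measure" and B X :: "real \<Rightarrow> 'a \<Rightarrow> real"
    and \<Delta> :: "real \<Rightarrow> real" and l \<gamma> x t \<alpha> :: real +
  fixes m n :: nat and K C :: real
  assumes m: "0 < m" and n: "0 < n" and K: "0 \<le> K" and C: "0 < C" "\<And>s. s \<in> {0..t} \<Longrightarrow> y s \<le> C"
begin

sublocale scheme: exponential_scheme M F B "step m n" "G m n K" "H m n K"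
  by (rule exponential_scheme) (rule m n)+

abbreviation "h \<equiv> step m n"
abbreviation "N \<equiv> m * n"

text \<open>The discrete quadratic variation without stopping; no fine step is switched off where it
  is at most K.\<close>

definition Q :: "'a \<Rightarrow> real" where "Q \<omega> = (\<Sum>j<N. (\<xi> m n j \<omega>)\<^sup>2 * h)"

lemma h: "0 < h" "real n * h = t / m" "real N * h = t"
  using step_pos[OF m n] m n by (simp_all add: step_def)

lemma D_eq: "scheme.D j \<omega> = dB m n j \<omega>"
  by (simp add: scheme.D_def dB_def)

lemma node_eq: "node m n j = (j div n) * (t / m)"
  using h(2) by (simp add: node_def mult_ac flip: h(2))

lemma div_less: "j < N \<Longrightarrow> j div n < m"
  using n by (simp add: less_mult_imp_div_less)

lemma node_in: "j < N \<Longrightarrow> node m n j \<in> {0..t}"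
proof -
  assume "j < N"
  then have "real (j div n) * (t / m) \<le> real m * (t / m)"
    using div_less[of j] t by (intro mult_right_mono) auto
  then show ?thesis using t m by (simp add: node_eq)
qed

text \<open>Clipping at the number n of fine steps per coarse cell makes the bound equal to 4 t / m.
  Hence stopping undershoots K by at most 4 t, whatever the grid.\<close>

lemma \<xi>_le: "(\<xi> m n j \<omega>)\<^sup>2 * h \<le> 4 * n * h"
proof -
  have "(\<xi> m n j \<omega>)\<^sup>2 \<le> 4 * n" by (simp add: \<xi>_def power_mult_distrib)
  then show ?thesis using h by (intro mult_right_mono) auto
qed

lemma V_eq: "scheme.V N \<omega> = (\<Sum>j<N. if (\<Sum>i\<le>j. (\<xi> m n i \<omega>)\<^sup>2 * h) \<le> K then (\<xi> m n j \<omega>)\<^sup>2 * h else 0)"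
  unfolding scheme.V_def H_def by (intro sum.cong) auto

lemma V_le: "scheme.V N \<omega> \<le> K"
  unfolding V_eq using h K \<xi>_le by (intro sum_stopped(1)[where b = "4 * n * h"]) auto

lemma V_ge: "K < Q \<omega> \<Longrightarrow> K - 4 * t \<le> scheme.V N \<omega>"
proof -
  assume "K < Q \<omega>"
  then have "K - 4 * n * h \<le> scheme.V N \<omega>"
    unfolding V_eq Q_def using h K \<xi>_le by (intro sum_stopped(2)[where b = "4 * n * h"]) auto
  moreover have "t / m \<le> t / 1" using m t by (intro divide_left_mono) auto
  ultimately show ?thesis using h(2) by simp
qed

lemma sum_blocks: "(\<Sum>j<N. f j) = (\<Sum>k<m. \<Sum>j=k*n..<k*n+n. f j)" for f :: "nat \<Rightarrow> real"
  by (rule sum.nat_group[symmetric])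

lemma div_block: "j \<in> {k*n..<k*n+n} \<Longrightarrow> j div n = k"
  using n by (intro div_nat_eqI) (auto simp: mult.commute)

lemma err_bounds:
  assumes "\<omega> \<in> space M - Bad \<eta> m n"
  shows "err1 m n \<omega> \<le> \<eta>" "k \<le> m \<Longrightarrow> err2 m n k \<omega> \<le> \<eta> / m" "\<bar>J m \<omega> - W \<omega>\<bar> \<le> \<eta>"
  using assms by (auto simp: Bad_def not_less)

text \<open>Without stopping H is \<xi>, and on a coarse cell the stochastic sum is an increment of
  X minus drift up to two node errors. The constant collects 2 C from the node errors, C^2 / 2 from
  \<open>err1\<close>, and 1 from J versus W.\<close>

lemma ln_E_close:
  assumes \<omega>: "\<omega> \<in> space M - Bad \<eta> m n" and "Q \<omega> \<le> K"
  shows "\<bar>ln (scheme.E N \<omega>) - W \<omega>\<bar> \<le> (2 * C + C\<^sup>2 / 2 + 1) * \<eta>"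
proof -
  note err = err_bounds[OF \<omega>]
  define c where "c j = y (node m n j)" for j
  define q where "q k = y (k * (t / m))" for k :: nat
  have qC: "\<bar>q k\<bar> \<le> C" if "k < m" for k
  proof -
    have "real k * (t / m) \<le> real m * (t / m)" using that t by (intro mult_right_mono) auto
    then have "k * (t / m) \<in> {0..t}" using t m by simp
    then show ?thesis using y_nonneg C(2) by (simp add: q_def)
  qed
  have cC: "\<bar>c j\<bar> \<le> C" if "j < N" for j
    using y_nonneg[OF node_in[OF that]] C(2)[OF node_in[OF that]] by (simp add: c_def)
  have cq: "c j = q k" if "j \<in> {k*n..<k*n+n}" for j k
    using div_block[OF that] by (simp add: c_def q_def node_eq)
  \<comment> \<open>The signed version of \<open>err2\<close>, whose increments appear when the sum
    over a cell is rewritten.\<close>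
  define R where "R k = x + (\<Sum>j<k * n. \<xi> m n j \<omega> * dB m n j \<omega>) + drift (k * (t / m)) - X (k * (t / m)) \<omega>" for k
  have R: "\<bar>R k\<bar> \<le> \<eta> / m" if "k \<le> m" for k
    using err(2)[OF that] by (simp add: R_def err2_def)
  have H: "H m n K j \<omega> = \<xi> m n j \<omega>" if "j < N" for j
  proof -
    have "(\<Sum>i\<le>j. (\<xi> m n i \<omega>)\<^sup>2 * h) \<le> Q \<omega>"
      unfolding Q_def using that h by (intro sum_mono2) auto
    then show ?thesis using assms(2) by (simp add: H_def)
  qed
  have "ln (scheme.E N \<omega>) = (\<Sum>j<N. G m n K j \<omega> * dB m n j \<omega> - (G m n K j \<omega>)\<^sup>2 * h / 2)"
    by (simp add: scheme.E_def D_eq)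
  also have "\<dots> = (\<Sum>j<N. - c j * (\<xi> m n j \<omega> * dB m n j \<omega>)) - (\<Sum>j<N. (c j)\<^sup>2 / 2 * ((\<xi> m n j \<omega>)\<^sup>2 * h))"
    unfolding sum_subtractf[symmetric]
    by (intro sum.cong refl) (simp add: G_def H c_def power_mult_distrib)
  also have "(\<Sum>j<N. - c j * (\<xi> m n j \<omega> * dB m n j \<omega>))
      = (\<Sum>k<m. - q k * (\<Sum>j=k*n..<k*n+n. \<xi> m n j \<omega> * dB m n j \<omega>))"
    unfolding sum_blocks sum_distrib_left by (intro sum.cong refl) (simp add: cq)
  also have "\<dots> = (\<Sum>k<m. - q k * (X (Suc k * (t / m)) \<omega> - X (k * (t / m)) \<omega>
               - (drift (Suc k * (t / m)) - drift (k * (t / m))))) - (\<Sum>k<m. q k * (R (Suc k) - R k))"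
  proof -
    have "(\<Sum>j=k*n..<k*n+n. \<xi> m n j \<omega> * dB m n j \<omega>) = R (Suc k) - R k
        + (X (Suc k * (t / m)) \<omega> - X (k * (t / m)) \<omega> - (drift (Suc k * (t / m)) - drift (k * (t / m))))" for k
    proof -
      have "(\<Sum>j<Suc k * n. \<xi> m n j \<omega> * dB m n j \<omega>)
          = (\<Sum>j<k * n. \<xi> m n j \<omega> * dB m n j \<omega>) + (\<Sum>j=k*n..<k*n+n. \<xi> m n j \<omega> * dB m n j \<omega>)"
        using sum.atLeastLessThan_concat[of 0 "k * n" "k * n + n" "\<lambda>j. \<xi> m n j \<omega> * dB m n j \<omega>"]
        by (simp add: lessThan_atLeast0 add.commute)
      then show ?thesis by (simp add: R_def)
    qed
    moreover have "- q k * (a + b) = - q k * b - q k * a" for k a b by (simp add: algebra_simps)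
    ultimately show ?thesis unfolding sum_subtractf[symmetric] by (intro sum.cong refl) (simp only:)
  qed
  finally have lnE: "ln (scheme.E N \<omega>) = (\<Sum>k<m. - q k * (X (Suc k * (t / m)) \<omega> - X (k * (t / m)) \<omega>
               - (drift (Suc k * (t / m)) - drift (k * (t / m))))) - (\<Sum>k<m. q k * (R (Suc k) - R k))
      - (\<Sum>j<N. (c j)\<^sup>2 / 2 * ((\<xi> m n j \<omega>)\<^sup>2 * h))" .
  \<comment> \<open>A coarse cell consists of n fine steps with the same node, so the coarse Riemann
    sum can be compared with the fine one term by term.\<close>
  have "(\<Sum>k<m. 2 * (q k)\<^sup>2 * X (k * (t / m)) \<omega> * (t / m)) = (\<Sum>j<N. 2 * (c j)\<^sup>2 * X (node m n j) \<omega> * h)"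
  proof -
    have "2 * (q k)\<^sup>2 * X (k * (t / m)) \<omega> * (t / m) = (\<Sum>j=k*n..<k*n+n. 2 * (c j)\<^sup>2 * X (node m n j) \<omega> * h)" for k
    proof -
      have "(\<Sum>j=k*n..<k*n+n. 2 * (c j)\<^sup>2 * X (node m n j) \<omega> * h)
          = (\<Sum>j=k*n..<k*n+n. 2 * (q k)\<^sup>2 * X (k * (t / m)) \<omega> * h)"
        by (intro sum.cong refl) (simp add: cq div_block node_eq)
      then show ?thesis by (simp flip: h(2))
    qed
    then show ?thesis unfolding sum_blocks by simp
  qed
  then have J: "J m \<omega> = (\<Sum>k<m. - q k * (X (Suc k * (t / m)) \<omega> - X (k * (t / m)) \<omega>
               - (drift (Suc k * (t / m)) - drift (k * (t / m)))))
         - (\<Sum>j<N. (c j)\<^sup>2 / 2 * (4 * X (node m n j) \<omega> * h))"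
    unfolding J_def q_def[symmetric] sum_subtractf by (simp add: mult_ac)
  have "\<bar>\<Sum>k<m. q k * (R (Suc k) - R k)\<bar> \<le> (\<Sum>k<m. C * (2 * (\<eta> / m)))"
  proof (intro order.trans[OF sum_abs] sum_mono)
    fix k assume k: "k \<in> {..<m}"
    have "\<bar>R (Suc k) - R k\<bar> \<le> 2 * (\<eta> / m)" using R[of k] R[of "Suc k"] k by auto
    then show "\<bar>q k * (R (Suc k) - R k)\<bar> \<le> C * (2 * (\<eta> / m))"
      unfolding abs_mult using qC k C(1) by (intro mult_mono) auto
  qed
  then have b1: "\<bar>\<Sum>k<m. q k * (R (Suc k) - R k)\<bar> \<le> 2 * C * \<eta>" using m by simp
  have "\<bar>\<Sum>j<N. (c j)\<^sup>2 / 2 * (h * ((\<xi> m n j \<omega>)\<^sup>2 - 4 * X (node m n j) \<omega>))\<bar>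
     \<le> (\<Sum>j<N. C\<^sup>2 / 2 * (h * \<bar>(\<xi> m n j \<omega>)\<^sup>2 - 4 * X (node m n j) \<omega>\<bar>))"
  proof (intro order.trans[OF sum_abs] sum_mono)
    fix j assume "j \<in> {..<N}"
    then have "(c j)\<^sup>2 \<le> C\<^sup>2" using cC[of j] C(1) by (simp add: abs_le_square_iff[symmetric])
    then show "\<bar>(c j)\<^sup>2 / 2 * (h * ((\<xi> m n j \<omega>)\<^sup>2 - 4 * X (node m n j) \<omega>))\<bar>
      \<le> C\<^sup>2 / 2 * (h * \<bar>(\<xi> m n j \<omega>)\<^sup>2 - 4 * X (node m n j) \<omega>\<bar>)"
      unfolding abs_mult using h by (intro mult_mono) auto
  qed
  also have "\<dots> = C\<^sup>2 / 2 * err1 m n \<omega>"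
    by (simp add: err1_def node_def sum_distrib_left)
  also have "\<dots> \<le> C\<^sup>2 / 2 * \<eta>" using err(1) by (intro mult_left_mono) auto
  finally have b2: "\<bar>\<Sum>j<N. (c j)\<^sup>2 / 2 * (h * ((\<xi> m n j \<omega>)\<^sup>2 - 4 * X (node m n j) \<omega>))\<bar> \<le> C\<^sup>2 / 2 * \<eta>" .
  have "ln (scheme.E N \<omega>) - J m \<omega> = - (\<Sum>k<m. q k * (R (Suc k) - R k))
     - (\<Sum>j<N. (c j)\<^sup>2 / 2 * (h * ((\<xi> m n j \<omega>)\<^sup>2 - 4 * X (node m n j) \<omega>)))"
    unfolding lnE J by (simp add: right_diff_distrib sum_subtractf mult_ac)
  then have "\<bar>ln (scheme.E N \<omega>) - W \<omega>\<bar> \<le> 2 * C * \<eta> + C\<^sup>2 / 2 * \<eta> + \<eta>"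
    using b1 b2 err(3) by linarith
  then show ?thesis by (simp add: algebra_simps)
qed

text \<open>Centring under the changed measure adds \<open>- G H h = y H\<^sup>2 h\<close> \<ge> 0
  to each increment, so before stopping A dominates the stochastic part of X at coarse nodes. After
  stopping the summands of V vanish, so the comparison is made only for indices that still
  count.\<close>

lemma V_le_on_good:
  assumes \<omega>: "\<omega> \<in> space M - Bad \<eta> m n" and \<eta>: "0 < \<eta>"
  shows "scheme.V N \<omega> \<le> \<eta> + (\<Sum>j<N. 4 * h * (x + drift t + \<eta> + \<bar>scheme.A (n * (j div n)) \<omega>\<bar>))"
proof -
  note err = err_bounds[OF \<omega>]
  have "scheme.V N \<omega> \<le> (\<Sum>j<N. h * \<bar>(\<xi> m n j \<omega>)\<^sup>2 - 4 * X (node m n j) \<omega>\<bar>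
      + 4 * h * (x + drift t + \<eta> + \<bar>scheme.A (n * (j div n)) \<omega>\<bar>))"
    unfolding V_eq
  proof (rule sum_mono)
    fix j assume "j \<in> {..<N}"
    then have j: "j < N" by simp
    define k where "k = j div n"
    have km: "k < m" using div_less[OF j] by (simp add: k_def)
    have kj: "k * n \<le> j" by (simp add: k_def)
    have "0 \<le> 4 * h * (x + drift t + \<eta> + \<bar>scheme.A (n * (j div n)) \<omega>\<bar>)"
      using h x drift_nonneg \<eta> by simp
    moreover have "(\<xi> m n j \<omega>)\<^sup>2 * h \<le> h * \<bar>(\<xi> m n j \<omega>)\<^sup>2 - 4 * X (node m n j) \<omega>\<bar>
         + 4 * h * (x + drift t + \<eta> + \<bar>scheme.A (n * (j div n)) \<omega>\<bar>)"
      if le: "(\<Sum>i\<le>j. (\<xi> m n i \<omega>)\<^sup>2 * h) \<le> K"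
    proof -
      have H: "H m n K i \<omega> = \<xi> m n i \<omega>" if "i < k * n" for i
      proof -
        have "(\<Sum>i\<le>i. (\<xi> m n i \<omega>)\<^sup>2 * h) \<le> (\<Sum>i\<le>j. (\<xi> m n i \<omega>)\<^sup>2 * h)"
          using that kj h by (intro sum_mono2) auto
        then show ?thesis using le by (simp add: H_def)
      qed
      have "(\<Sum>i<k * n. \<xi> m n i \<omega> * dB m n i \<omega>) \<le> scheme.A (k * n) \<omega>"
        unfolding scheme.A_def
      proof (rule sum_mono)
        fix i assume i: "i \<in> {..<k * n}"
        then have "i < N" using kj j by auto
        then have "0 \<le> y (node m n i) * (H m n K i \<omega>)\<^sup>2 * h"
          using y_nonneg[OF node_in] h by simp
        then show "\<xi> m n i \<omega> * dB m n i \<omega> \<le> H m n K i \<omega> * (scheme.D i \<omega> - G m n K i \<omega> * h)"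
          using H[of i] i by (simp add: D_eq G_def power2_eq_square algebra_simps)
      qed
      moreover have "drift (k * (t / m)) \<le> drift t"
      proof -
        have "real k * (t / m) \<le> real m * (t / m)" using km t by (intro mult_right_mono) auto
        then show ?thesis using t m by (intro drift_mono) auto
      qed
      moreover have "err2 m n k \<omega> \<le> \<eta> / m" using err(2) km by simp
      moreover have "\<eta> / m \<le> \<eta> / 1" using m \<eta> by (intro divide_left_mono) auto
      ultimately have "X (k * (t / m)) \<omega> \<le> x + drift t + \<eta> + \<bar>scheme.A (k * n) \<omega>\<bar>"
        unfolding err2_def by linarith
      then have "X (node m n j) \<omega> \<le> x + drift t + \<eta> + \<bar>scheme.A (n * (j div n)) \<omega>\<bar>"
        by (simp add: node_eq k_def mult.commute)
      then have "(\<xi> m n j \<omega>)\<^sup>2 \<le> \<bar>(\<xi> m n j \<omega>)\<^sup>2 - 4 * X (node m n j) \<omega>\<bar>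
          + 4 * (x + drift t + \<eta> + \<bar>scheme.A (n * (j div n)) \<omega>\<bar>)"
        using abs_ge_self[of "(\<xi> m n j \<omega>)\<^sup>2 - 4 * X (node m n j) \<omega>"] by argo
      from mult_left_mono[OF this, of h] h(1) show ?thesis by (simp add: algebra_simps)
    qed
    ultimately show "(if (\<Sum>i\<le>j. (\<xi> m n i \<omega>)\<^sup>2 * h) \<le> K then (\<xi> m n j \<omega>)\<^sup>2 * h else 0)
       \<le> h * \<bar>(\<xi> m n j \<omega>)\<^sup>2 - 4 * X (node m n j) \<omega>\<bar>
      + 4 * h * (x + drift t + \<eta> + \<bar>scheme.A (n * (j div n)) \<omega>\<bar>)"
      using h by (simp add: add_nonneg_nonneg)
  qed
  also have "\<dots> = err1 m n \<omega> + (\<Sum>j<N. 4 * h * (x + drift t + \<eta> + \<bar>scheme.A (n * (j div n)) \<omega>\<bar>))"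
    by (simp add: sum.distrib err1_def node_def)
  finally show ?thesis using err(1) by simp
qed

end

section \<open>The stochastic exponential has expectation one\<close>

lemma integral_le_of_nn_integral_le:
  fixes f :: "'a \<Rightarrow> real"
  assumes "f \<in> borel_measurable M" "\<And>x. 0 \<le> f x" "0 \<le> c" "(\<integral>\<^sup>+x. ennreal (f x) \<partial>M) \<le> ennreal c"
  shows "integrable M f" "integral\<^sup>L M f \<le> c"
proof -
  show int: "integrable M f"
    using assms by (intro integrableI_nonneg) (auto simp: le_less_trans)
  have "ennreal (integral\<^sup>L M f) \<le> ennreal c"
    using nn_integral_eq_integral[OF int] assms by simp
  then show "integral\<^sup>L M f \<le> c" using assms(3) by simp
qed

context squared_bessel_process
begin

lemma W_le: "AE \<omega> in M. exp (W \<omega>) \<le> exp (phi \<alpha> t l * x + psi \<alpha> \<Delta> t l)"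
  using AE_X
proof eventually_elim
  case (elim \<omega>)
  then have "0 \<le> (LBINT u:{0..t}. X u \<omega>)"
    unfolding set_lebesgue_integral_def by (intro Bochner_Integration.integral_nonneg) (auto simp: indicator_def)
  moreover have "0 \<le> X t \<omega>" using elim t by simp
  ultimately have "0 \<le> l * X t \<omega>" "0 \<le> \<gamma> * (LBINT u:{0..t}. X u \<omega>)" using l \<gamma> by simp_all
  then show ?case unfolding W_def exp_le_cancel_iff by linarith
qed

lemma integrable_exp_W: "integrable M (\<lambda>\<omega>. exp (W \<omega>))"
  using W_le by (intro integrable_const_bound[where B = "exp (phi \<alpha> t l * x + psi \<alpha> \<Delta> t l)"]) auto

end

section \<open>Moments of the stopped exponential\<close>

context discretized_bessel
begin

abbreviation "E \<equiv> scheme.E N"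
abbreviation "V \<equiv> scheme.V N"

lemma E_measurable[measurable]: "E \<in> borel_measurable M"
  by (rule measurable_F_M, rule scheme.E_measurable)

lemma V_measurable[measurable]: "V \<in> borel_measurable M"
  by (rule measurable_F_M, rule scheme.V_measurable')

lemma A_measurable[measurable]: "scheme.A k \<in> borel_measurable M"
  by (rule measurable_F_M, rule scheme.A_measurable)

lemma E_nonneg: "0 \<le> E \<omega>" by (rule less_imp_le, rule scheme.E_pos)

lemma integrable_E: "integrable M E" and integral_E: "(\<integral>\<omega>. E \<omega> \<partial>M) = 1"
proof -
  show "integrable M E"
    by (rule integral_le_of_nn_integral_le[where c = 1]) (simp_all add: E_nonneg scheme.nn_integral_E)
  then show "(\<integral>\<omega>. E \<omega> \<partial>M) = 1"
    using scheme.nn_integral_E[of N] by (simp add: nn_integral_eq_integral E_nonneg)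
qed

text \<open>G^2 is at most C^2 H^2, and stopping bounds the sum of H^2 h by K.\<close>

lemma integrable_E_square: "integrable M (\<lambda>\<omega>. (E \<omega>)\<^sup>2)"
  and integral_E_square: "(\<integral>\<omega>. (E \<omega>)\<^sup>2 \<partial>M) \<le> exp (C\<^sup>2 * K)"
proof -
  have "(\<Sum>j<N. (G m n K j \<omega>)\<^sup>2 * h) \<le> C\<^sup>2 * K" for \<omega>
  proof -
    have "(\<Sum>j<N. (G m n K j \<omega>)\<^sup>2 * h) \<le> (\<Sum>j<N. C\<^sup>2 * ((H m n K j \<omega>)\<^sup>2 * h))"
    proof (rule sum_mono)
      fix j assume "j \<in> {..<N}"
      then have "(y (node m n j))\<^sup>2 \<le> C\<^sup>2"
        using y_nonneg[OF node_in] C(2)[OF node_in] by (intro power_mono) auto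
      then have "(y (node m n j))\<^sup>2 * ((H m n K j \<omega>)\<^sup>2 * h) \<le> C\<^sup>2 * ((H m n K j \<omega>)\<^sup>2 * h)"
        using h by (intro mult_right_mono) auto
      then show "(G m n K j \<omega>)\<^sup>2 * h \<le> C\<^sup>2 * ((H m n K j \<omega>)\<^sup>2 * h)"
        by (simp add: G_def power_mult_distrib mult.assoc)
    qed
    also have "\<dots> = C\<^sup>2 * V \<omega>" by (simp add: scheme.V_def sum_distrib_left)
    also have "\<dots> \<le> C\<^sup>2 * K" using V_le by (intro mult_left_mono) auto
    finally show ?thesis .
  qed
  then have "(\<integral>\<^sup>+\<omega>. ennreal ((E \<omega>)\<^sup>2) \<partial>M) \<le> ennreal (exp (C\<^sup>2 * K))"
    by (rule scheme.nn_integral_E_square_le)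
  then show "integrable M (\<lambda>\<omega>. (E \<omega>)\<^sup>2)" "(\<integral>\<omega>. (E \<omega>)\<^sup>2 \<partial>M) \<le> exp (C\<^sup>2 * K)"
    by (intro integral_le_of_nn_integral_le; simp)+
qed

lemma integrable_E_V: "integrable M (\<lambda>\<omega>. E \<omega> * V \<omega>)"
proof (rule Bochner_Integration.integrable_bound[where f = "\<lambda>\<omega>. K * E \<omega>"])
  show "AE \<omega> in M. norm (E \<omega> * V \<omega>) \<le> norm (K * E \<omega>)"
  proof (rule AE_I2)
    fix \<omega>
    have "E \<omega> * V \<omega> \<le> E \<omega> * K" using V_le E_nonneg by (intro mult_left_mono) auto
    then show "norm (E \<omega> * V \<omega>) \<le> norm (K * E \<omega>)"
      using E_nonneg scheme.V_nonneg K by (simp add: abs_mult mult.commute)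
  qed
qed (use integrable_E in simp_all)

lemma
  assumes "k \<le> N"
  shows integrable_E_A2: "integrable M (\<lambda>\<omega>. E \<omega> * (scheme.A k \<omega>)\<^sup>2)"
    and integral_E_A2_le: "(\<integral>\<omega>. E \<omega> * (scheme.A k \<omega>)\<^sup>2 \<partial>M) \<le> (\<integral>\<omega>. E \<omega> * V \<omega> \<partial>M)"
proof -
  have "(\<integral>\<^sup>+\<omega>. ennreal (E \<omega> * (scheme.A k \<omega>)\<^sup>2) \<partial>M) \<le> (\<integral>\<^sup>+\<omega>. ennreal (E \<omega> * V \<omega>) \<partial>M)"
    by (rule scheme.nn_integral_E_A2_le[OF assms])
  also have "\<dots> = ennreal (\<integral>\<omega>. E \<omega> * V \<omega> \<partial>M)"
    using E_nonneg scheme.V_nonneg by (intro nn_integral_eq_integral integrable_E_V) simp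
  finally have *: "(\<integral>\<^sup>+\<omega>. ennreal (E \<omega> * (scheme.A k \<omega>)\<^sup>2) \<partial>M) \<le> ennreal (\<integral>\<omega>. E \<omega> * V \<omega> \<partial>M)" .
  have nonneg: "0 \<le> (\<integral>\<omega>. E \<omega> * V \<omega> \<partial>M)"
    using E_nonneg scheme.V_nonneg by (intro Bochner_Integration.integral_nonneg) simp
  show "integrable M (\<lambda>\<omega>. E \<omega> * (scheme.A k \<omega>)\<^sup>2)"
    by (rule integral_le_of_nn_integral_le(1)[OF _ _ nonneg *]) (simp_all add: E_nonneg)
  show "(\<integral>\<omega>. E \<omega> * (scheme.A k \<omega>)\<^sup>2 \<partial>M) \<le> (\<integral>\<omega>. E \<omega> * V \<omega> \<partial>M)"
    by (rule integral_le_of_nn_integral_le(2)[OF _ _ nonneg *]) (simp_all add: E_nonneg)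
qed

lemma integrable_E_Bad: "integrable M (\<lambda>\<omega>. E \<omega> * indicator (Bad \<eta> m n) \<omega>)"
  by (intro integrable_real_mult_indicator Bad_measurable integrable_E)

text \<open>Truncation at level a: E is at most a, or else at most E^2 / a. The level is balanced
  against the probability of \<open>Bad\<close> only at the end.\<close>

lemma integral_E_Bad_le:
  assumes a: "0 < a"
  shows "(\<integral>\<omega>. E \<omega> * indicator (Bad \<eta> m n) \<omega> \<partial>M) \<le> exp (C\<^sup>2 * K) / a + a * measure M (Bad \<eta> m n)"
proof -
  have "(\<integral>\<omega>. E \<omega> * indicator (Bad \<eta> m n) \<omega> \<partial>M) \<le> (\<integral>\<omega>. (E \<omega>)\<^sup>2 / a + a * indicator (Bad \<eta> m n) \<omega> \<partial>M)"
  proof (rule integral_mono)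
    show "E \<omega> * indicator (Bad \<eta> m n) \<omega> \<le> (E \<omega>)\<^sup>2 / a + a * indicator (Bad \<eta> m n) \<omega>" for \<omega>
    proof (cases "E \<omega> \<le> a")
      case True
      then show ?thesis using a by (auto simp: indicator_def add_increasing)
    next
      case False
      then have "E \<omega> * 1 \<le> E \<omega> * (E \<omega> / a)" using a by (intro mult_left_mono) auto
      then show ?thesis using a by (auto simp: indicator_def power2_eq_square)
    qed
  next
    show "integrable M (\<lambda>\<omega>. (E \<omega>)\<^sup>2 / a + a * indicator (Bad \<eta> m n) \<omega>)"
      using integrable_E_square by (auto simp: emeasure_eq_measure)
  qed (rule integrable_E_Bad)
  also have "\<dots> = (\<integral>\<omega>. (E \<omega>)\<^sup>2 \<partial>M) / a + a * measure M (Bad \<eta> m n)"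
    using integrable_E_square by (subst Bochner_Integration.integral_add) (auto simp: emeasure_eq_measure)
  also have "\<dots> \<le> exp (C\<^sup>2 * K) / a + a * measure M (Bad \<eta> m n)"
    using a integral_E_square by (simp add: divide_right_mono)
  finally show ?thesis .
qed

text \<open>Off \<open>Bad\<close>, V is bounded linearly in |A|, and the second moments of A are
  bounded by v itself. The resulting v / 2 can be absorbed on the left because v is finite, V being
  at most K; on \<open>Bad\<close> that same bound produces the last term.\<close>

lemma integral_E_V_le:
  assumes \<eta>: "0 < \<eta>"
  shows "(\<integral>\<omega>. E \<omega> * V \<omega> \<partial>M) \<le> 2 * (\<eta> + 4 * t * (x + drift t + \<eta> + 2 * t)
      + K * (\<integral>\<omega>. E \<omega> * indicator (Bad \<eta> m n) \<omega> \<partial>M))"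
proof -
  define c where "c = x + drift t + \<eta> + 2 * t"
  define v where "v = (\<integral>\<omega>. E \<omega> * V \<omega> \<partial>M)"
  define r where "r j = n * (j div n)" for j
  have rN: "r j \<le> N" if "j < N" for j
    using that times_div_less_eq_dividend[of n j] unfolding r_def by linarith
  have pt: "E \<omega> * V \<omega> \<le> \<eta> * E \<omega> + (\<Sum>j<N. 4 * h * (c * E \<omega> + (E \<omega> * (scheme.A (r j) \<omega>)\<^sup>2) / (8 * t)))
      + K * (E \<omega> * indicator (Bad \<eta> m n) \<omega>)" if \<omega>: "\<omega> \<in> space M" for \<omega>
  proof (cases "\<omega> \<in> Bad \<eta> m n")
    case True
    have "0 \<le> c" using x drift_nonneg \<eta> t by (simp add: c_def)
    then have "0 \<le> \<eta> * E \<omega> + (\<Sum>j<N. 4 * h * (c * E \<omega> + (E \<omega> * (scheme.A (r j) \<omega>)\<^sup>2) / (8 * t)))"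
      using \<eta> h t E_nonneg by (intro add_nonneg_nonneg sum_nonneg mult_nonneg_nonneg divide_nonneg_nonneg) auto
    moreover have "E \<omega> * V \<omega> \<le> E \<omega> * K" using V_le E_nonneg by (intro mult_left_mono) auto
    ultimately show ?thesis using True by (simp add: mult.commute)
  next
    case False
    \<comment> \<open>The weight 1 / (8 t) is chosen so that the total factor 4 t of the time sum
      leaves exactly v / 2.\<close>
    have abs_le: "\<bar>z\<bar> \<le> z\<^sup>2 / (8 * t) + 2 * t" for z
    proof -
      have "0 \<le> (\<bar>z\<bar> - 4 * t)\<^sup>2 / (8 * t)" using t by simp
      also have "\<dots> = z\<^sup>2 / (8 * t) + 2 * t - \<bar>z\<bar>"
        using t by (simp add: power2_diff field_simps) (simp add: power2_eq_square)
      finally show ?thesis by simp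
    qed
    have "V \<omega> \<le> \<eta> + (\<Sum>j<N. 4 * h * (x + drift t + \<eta> + \<bar>scheme.A (r j) \<omega>\<bar>))"
      unfolding r_def using \<omega> False \<eta> by (intro V_le_on_good) auto
    also have "\<dots> \<le> \<eta> + (\<Sum>j<N. 4 * h * (c + (scheme.A (r j) \<omega>)\<^sup>2 / (8 * t)))"
    proof (intro add_left_mono sum_mono mult_left_mono)
      show "x + drift t + \<eta> + \<bar>scheme.A (r j) \<omega>\<bar> \<le> c + (scheme.A (r j) \<omega>)\<^sup>2 / (8 * t)" for j
        using abs_le[of "scheme.A (r j) \<omega>"] by (simp add: c_def)
    qed (use h in auto)
    finally have "E \<omega> * V \<omega> \<le> E \<omega> * \<dots>" using E_nonneg by (intro mult_left_mono)
    also have "\<dots> = \<eta> * E \<omega> + (\<Sum>j<N. 4 * h * (c * E \<omega> + (E \<omega> * (scheme.A (r j) \<omega>)\<^sup>2) / (8 * t)))"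
      unfolding distrib_left sum_distrib_left by (intro arg_cong2[where f = "(+)"] sum.cong) (auto simp: algebra_simps)
    finally show ?thesis using False by simp
  qed
  define f where "f j \<omega> = 4 * h * (c * E \<omega> + (E \<omega> * (scheme.A (r j) \<omega>)\<^sup>2) / (8 * t))" for j \<omega>
  have int_f: "integrable M (f j)" if "j < N" for j
    unfolding f_def[abs_def] using rN[OF that]
    by (intro integrable_mult_right Bochner_Integration.integrable_add integrable_divide integrable_E integrable_E_A2)
  have int_sum: "integrable M (\<lambda>\<omega>. \<Sum>j<N. f j \<omega>)"
    using int_f by (intro Bochner_Integration.integrable_sum) auto
  have "v \<le> (\<integral>\<omega>. \<eta> * E \<omega> + (\<Sum>j<N. f j \<omega>) + K * (E \<omega> * indicator (Bad \<eta> m n) \<omega>) \<partial>M)"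
    unfolding v_def
  proof (rule integral_mono)
    show "integrable M (\<lambda>\<omega>. \<eta> * E \<omega> + (\<Sum>j<N. f j \<omega>) + K * (E \<omega> * indicator (Bad \<eta> m n) \<omega>))"
      by (intro Bochner_Integration.integrable_add integrable_mult_right integrable_E integrable_E_Bad int_sum)
  qed (use integrable_E_V pt in \<open>simp_all only: f_def\<close>)
  also have "\<dots> = (\<integral>\<omega>. \<eta> * E \<omega> \<partial>M) + (\<integral>\<omega>. (\<Sum>j<N. f j \<omega>) \<partial>M) + (\<integral>\<omega>. K * (E \<omega> * indicator (Bad \<eta> m n) \<omega>) \<partial>M)"
    using integrable_E integrable_E_Bad int_sum
    by (simp only: Bochner_Integration.integral_add Bochner_Integration.integrable_add integrable_mult_right)
  also have "\<dots> = \<eta> + (\<Sum>j<N. \<integral>\<omega>. f j \<omega> \<partial>M) + K * (\<integral>\<omega>. E \<omega> * indicator (Bad \<eta> m n) \<omega> \<partial>M)"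
    using int_f by (subst Bochner_Integration.integral_sum) (auto simp: integral_E)
  also have "\<dots> \<le> \<eta> + (\<Sum>j<N. 4 * h * (c + v / (8 * t))) + K * (\<integral>\<omega>. E \<omega> * indicator (Bad \<eta> m n) \<omega> \<partial>M)"
  proof (intro add_mono sum_mono order.refl)
    fix j assume "j \<in> {..<N}"
    then have rj: "r j \<le> N" using rN by simp
    have "(\<integral>\<omega>. f j \<omega> \<partial>M) = 4 * h * (c + (\<integral>\<omega>. E \<omega> * (scheme.A (r j) \<omega>)\<^sup>2 \<partial>M) / (8 * t))"
      unfolding f_def using integrable_E integrable_E_A2[OF rj] integral_E by simp
    also have "\<dots> \<le> 4 * h * (c + v / (8 * t))"
      unfolding v_def using h t integral_E_A2_le[OF rj] by (intro mult_left_mono add_left_mono divide_right_mono) auto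
    finally show "(\<integral>\<omega>. f j \<omega> \<partial>M) \<le> 4 * h * (c + v / (8 * t))" .
  qed
  also have "(\<Sum>j<N. 4 * h * (c + v / (8 * t))) = 4 * t * (c + v / (8 * t))"
    using h(3) by simp
  also have "\<dots> = 4 * t * c + v / 2" using t by (simp add: distrib_left)
  finally show ?thesis unfolding v_def[symmetric] c_def by argo
qed

section \<open>Comparison with exp W and passage to the limit\<close>

definition rate :: real where "rate = 2 * C + C\<^sup>2 / 2 + 1"

lemma E_close:
  assumes "\<omega> \<in> space M - Bad \<eta> m n" and "Q \<omega> \<le> K"
  shows "exp (W \<omega>) \<le> exp (rate * \<eta>) * E \<omega>" "E \<omega> \<le> exp (rate * \<eta>) * exp (W \<omega>)"
proof -
  have "\<bar>ln (E \<omega>) - W \<omega>\<bar> \<le> rate * \<eta>"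
    unfolding rate_def using assms by (rule ln_E_close)
  then have "W \<omega> \<le> rate * \<eta> + ln (E \<omega>)" "ln (E \<omega>) \<le> rate * \<eta> + W \<omega>" by linarith+
  then have "exp (W \<omega>) \<le> exp (rate * \<eta> + ln (E \<omega>))" "exp (ln (E \<omega>)) \<le> exp (rate * \<eta> + W \<omega>)"
    by simp_all
  then show "exp (W \<omega>) \<le> exp (rate * \<eta>) * E \<omega>" "E \<omega> \<le> exp (rate * \<eta>) * exp (W \<omega>)"
    using scheme.E_pos[of N \<omega>] by (simp_all add: exp_add)
qed

text \<open>Clipping alone gives \<open>Q\<close> \<le> 4 n t, so with this K no path is stopped. On
  \<open>Bad\<close> the deterministic bound \<open>W_le\<close> replaces any estimate of E.\<close>

lemma integral_exp_W_le:
  assumes "4 * n * t \<le> K"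
  shows "(\<integral>\<omega>. exp (W \<omega>) \<partial>M) \<le> exp (rate * \<eta>) + exp (phi \<alpha> t l * x + psi \<alpha> \<Delta> t l) * measure M (Bad \<eta> m n)"
proof -
  let ?c = "exp (phi \<alpha> t l * x + psi \<alpha> \<Delta> t l)"
  have Q: "Q \<omega> \<le> K" for \<omega>
  proof -
    have "Q \<omega> \<le> (\<Sum>j<N. 4 * n * h)" unfolding Q_def by (intro sum_mono \<xi>_le)
    also have "\<dots> = 4 * n * (real N * h)" by simp
    finally show ?thesis unfolding h(3) using assms by simp
  qed
  have "(\<integral>\<omega>. exp (W \<omega>) \<partial>M) \<le> (\<integral>\<omega>. exp (rate * \<eta>) * E \<omega> + ?c * indicator (Bad \<eta> m n) \<omega> \<partial>M)"
  proof (rule integral_mono_AE)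
    show "AE \<omega> in M. exp (W \<omega>) \<le> exp (rate * \<eta>) * E \<omega> + ?c * indicator (Bad \<eta> m n) \<omega>"
      using W_le AE_space
    proof eventually_elim
      case (elim \<omega>)
      have "0 \<le> exp (rate * \<eta>) * E \<omega>" using E_nonneg by simp
      then show ?case
        using elim E_close(1)[of \<omega> \<eta>] Q[of \<omega>]
        by (cases "\<omega> \<in> Bad \<eta> m n") (simp_all del: exp_le_cancel_iff)
    qed
  qed (use integrable_exp_W integrable_E in \<open>auto simp: emeasure_eq_measure\<close>)
  also have "\<dots> = exp (rate * \<eta>) + ?c * measure M (Bad \<eta> m n)"
    using integrable_E integral_E by (subst Bochner_Integration.integral_add) (auto simp: emeasure_eq_measure)
  finally show ?thesis .
qed

text \<open>The mass 1 of E is split over the bad event, the good stopped paths and the good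
  unstopped paths. On the stopped ones V is at least K - 4 t, which is Markov's inequality under the
  changed measure.\<close>

lemma one_le_integral_exp_W:
  assumes "4 * t < K"
  shows "1 \<le> (\<integral>\<omega>. E \<omega> * indicator (Bad \<eta> m n) \<omega> \<partial>M) + (\<integral>\<omega>. E \<omega> * V \<omega> \<partial>M) / (K - 4 * t)
     + exp (rate * \<eta>) * (\<integral>\<omega>. exp (W \<omega>) \<partial>M)"
proof -
  have "(\<integral>\<omega>. E \<omega> \<partial>M) \<le> (\<integral>\<omega>. E \<omega> * indicator (Bad \<eta> m n) \<omega> + (E \<omega> * V \<omega>) / (K - 4 * t)
     + exp (rate * \<eta>) * exp (W \<omega>) \<partial>M)"
  proof (rule integral_mono)
    fix \<omega> assume \<omega>: "\<omega> \<in> space M"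
    have nonneg: "0 \<le> (E \<omega> * V \<omega>) / (K - 4 * t)" "0 \<le> exp (rate * \<eta>) * exp (W \<omega>)"
      using E_nonneg scheme.V_nonneg assms by simp_all
    consider "\<omega> \<in> Bad \<eta> m n" | "\<omega> \<notin> Bad \<eta> m n" "Q \<omega> \<le> K" | "\<omega> \<notin> Bad \<eta> m n" "K < Q \<omega>" by fastforce
    then show "E \<omega> \<le> E \<omega> * indicator (Bad \<eta> m n) \<omega> + (E \<omega> * V \<omega>) / (K - 4 * t)
       + exp (rate * \<eta>) * exp (W \<omega>)"
    proof cases
      case 1
      then show ?thesis using nonneg by simp
    next
      case 2
      then show ?thesis using nonneg E_close(2)[of \<omega> \<eta>] \<omega> by simp
    next
      case 3
      then have "E \<omega> * (K - 4 * t) \<le> E \<omega> * V \<omega>" using V_ge E_nonneg by (intro mult_left_mono) auto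
      then have "E \<omega> \<le> (E \<omega> * V \<omega>) / (K - 4 * t)" using assms by (simp add: pos_le_divide_eq)
      moreover have "E \<omega> * indicator (Bad \<eta> m n) \<omega> = 0" using 3 by simp
      ultimately show ?thesis using nonneg(2) by linarith
    qed
  qed (intro integrable_E integrable_E_Bad Bochner_Integration.integrable_add integrable_divide
      integrable_E_V integrable_mult_right integrable_exp_W)+
  then show ?thesis
    using integral_E integrable_E_Bad[of \<eta>] integrable_E_V integrable_exp_W by simp
qed

end

context squared_bessel_process
begin

lemma expectation_exp_W: "(\<integral>\<omega>. exp (W \<omega>) \<partial>M) = 1"
proof -
  obtain C where C: "0 < C" "\<And>s. s \<in> {0..t} \<Longrightarrow> y s \<le> C" using y_bounded by blast
  define \<rho> where "\<rho> = 2 * C + C\<^sup>2 / 2 + 1"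
  define c0 where "c0 = exp (phi \<alpha> t l * x + psi \<alpha> \<Delta> t l)"
  \<comment> \<open>The bound of \<open>integral_E_V_le\<close> with \<eta> replaced by 1 and the
    contribution of the bad event by 2; it is free of K.\<close>
  define c1 where "c1 = 2 * (1 + 4 * t * (x + drift t + 1 + 2 * t) + 2)"
  let ?Z = "\<integral>\<omega>. exp (W \<omega>) \<partial>M"
  have upper: "?Z \<le> exp (\<rho> * (1 / Suc k)) + c0 * (1 / Suc k)" for k
  proof -
    obtain m n where mn: "0 < m" "0 < n" and Bad: "measure M (Bad (1 / Suc k) m n) < 1 / Suc k"
      by (rule Bad_small[of "1 / Suc k" "1 / Suc k"]) auto
    interpret discretized_bessel M F B X \<Delta> l \<gamma> x t \<alpha> m n "4 * n * t" C
      by unfold_locales (use mn t C in auto)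
    have "?Z \<le> exp (\<rho> * (1 / Suc k)) + c0 * measure M (Bad (1 / Suc k) m n)"
      using integral_exp_W_le[of "1 / Suc k"] by (simp add: rate_def \<rho>_def c0_def)
    also have "\<dots> \<le> exp (\<rho> * (1 / Suc k)) + c0 * (1 / Suc k)"
      using Bad by (intro add_left_mono mult_left_mono) (auto simp: c0_def)
    finally show ?thesis .
  qed
  have lower: "1 \<le> 2 * (1 / Suc k) + c1 * (1 / Suc k) + exp (\<rho> * (1 / Suc k)) * ?Z" for k
  proof -
    \<comment> \<open>K - 4 t is the Markov denominator k + 1. With this a and a bad event of
      probability below 1 / (K a), both terms of the truncation bound are at most 1 / K, so K b
      \<le> 2.\<close>
    define K \<eta> a where "K = Suc k + 4 * t" and "\<eta> = 1 / real (Suc k)" and "a = K * exp (C\<^sup>2 * K)"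
    have K_pos: "0 < K" "4 * t < K" "K - 4 * t = Suc k" using t by (auto simp: K_def)
    have \<eta>: "0 < \<eta>" "\<eta> \<le> 1" by (simp_all add: \<eta>_def)
    have a: "0 < a" using K_pos by (simp add: a_def)
    obtain m n where mn: "0 < m" "0 < n" and Bad: "measure M (Bad \<eta> m n) < 1 / (K * a)"
      by (rule Bad_small[of \<eta> "1 / (K * a)"]) (use a K_pos \<eta> in auto)
    interpret discretized_bessel M F B X \<Delta> l \<gamma> x t \<alpha> m n K C
      by unfold_locales (use mn K_pos C in auto)
    define b where "b = (\<integral>\<omega>. E \<omega> * indicator (Bad \<eta> m n) \<omega> \<partial>M)"
    have "b \<le> exp (C\<^sup>2 * K) / a + a * measure M (Bad \<eta> m n)"
      unfolding b_def by (rule integral_E_Bad_le[OF a])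
    also have "\<dots> \<le> exp (C\<^sup>2 * K) / a + a * (1 / (K * a))"
      using Bad a by (intro add_left_mono mult_left_mono) auto
    also have "\<dots> = 2 / K" using a K_pos by (simp add: a_def)
    finally have b: "b \<le> 2 / K" .
    then have Kb: "K * b \<le> 2" using mult_left_mono[OF b, of K] K_pos by simp
    have "2 / K \<le> 2 / Suc k" using t by (intro divide_left_mono) (auto simp: K_def)
    then have b': "b \<le> 2 * (1 / Suc k)" using b by simp
    have "(\<integral>\<omega>. E \<omega> * V \<omega> \<partial>M) \<le> 2 * (\<eta> + 4 * t * (x + drift t + \<eta> + 2 * t) + K * b)"
      unfolding b_def by (rule integral_E_V_le[OF \<eta>(1)])
    also have "\<dots> \<le> c1"
      unfolding c1_def using \<eta> Kb t by (intro mult_left_mono add_mono) auto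
    finally have "(\<integral>\<omega>. E \<omega> * V \<omega> \<partial>M) / (K - 4 * t) \<le> c1 * (1 / Suc k)"
      unfolding K_pos(3) by (simp add: divide_right_mono)
    moreover have "rate = \<rho>" by (simp add: rate_def \<rho>_def)
    ultimately show ?thesis
      using one_le_integral_exp_W[OF K_pos(2), of \<eta>] b' unfolding b_def \<eta>_def by simp
  qed
  have lim: "(\<lambda>k. 1 / Suc k) \<longlonglongrightarrow> (0 :: real)"
    using LIMSEQ_inverse_real_of_nat by (simp add: inverse_eq_divide)
  have "(\<lambda>k. exp (\<rho> * (1 / Suc k)) + c0 * (1 / Suc k)) \<longlonglongrightarrow> exp (\<rho> * 0) + c0 * 0"
    by (intro tendsto_intros lim)
  then have "?Z \<le> exp (\<rho> * 0) + c0 * 0"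
    by (rule LIMSEQ_le_const) (use upper in auto)
  moreover have "(\<lambda>k. 2 * (1 / Suc k) + c1 * (1 / Suc k) + exp (\<rho> * (1 / Suc k)) * ?Z)
      \<longlonglongrightarrow> 2 * 0 + c1 * 0 + exp (\<rho> * 0) * ?Z"
    by (intro tendsto_intros lim)
  then have "1 \<le> 2 * 0 + c1 * 0 + exp (\<rho> * 0) * ?Z"
    by (rule LIMSEQ_le_const) (use lower in auto)
  ultimately show ?thesis by simp
qed

end

theorem proposition3p16:
  fixes M :: "'a measure" and F :: "real \<Rightarrow> 'a measure" and B X :: "real \<Rightarrow> 'a \<Rightarrow> real"
    and \<Delta> :: "real \<Rightarrow> real" and l \<gamma> x t \<alpha> :: real
  assumes "brownian_motion M F B"
    and "l \<ge> 0" and "\<gamma> > 0" and "x \<ge> 0"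
    and "continuous_on {0..} \<Delta>" and "\<And>u. u \<ge> 0 \<Longrightarrow> \<Delta> u \<ge> 0"
    and "generalized_squared_bessel M F B \<Delta> x X"
    and "\<alpha> = sqrt (\<gamma> / 2)"
    and "t \<ge> 0"
  shows "prob_space.expectation M (\<lambda>\<omega>. exp (- l * X t \<omega> - \<gamma> * (LBINT u:{0..t}. X u \<omega>)))
           = exp (- x * phi \<alpha> t l - psi \<alpha> \<Delta> t l)"
proof (cases "t = 0")
  \<comment> \<open>The grids degenerate for t = 0; here the path integral is over a point and both
    sides are exp (- l x).\<close>
  case True
  interpret brownian_motion M F B by fact
  have \<alpha>: "0 < \<alpha>" using assms by simp
  have "AE \<omega> in M. X 0 \<omega> = x"
    using assms(7) by (simp add: generalized_squared_bessel_def)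
  then have "expectation (\<lambda>\<omega>. exp (- l * X 0 \<omega> - \<gamma> * (LBINT u:{0..0}. X u \<omega>))) = expectation (\<lambda>\<omega>. exp (- l * x))"
  proof (intro integral_cong_AE)
    show "(\<lambda>\<omega>. exp (- l * X 0 \<omega> - \<gamma> * (LBINT u:{0..0}. X u \<omega>))) \<in> borel_measurable M"
    proof -
      have [measurable]: "X 0 \<in> borel_measurable M"
        using assms(7) by (intro measurable_F_M[of _ 0] progressive_measurable) (simp_all add: generalized_squared_bessel_def)
      show ?thesis by (simp add: set_integral_at_point)
    qed
  qed (auto simp: set_integral_at_point)
  then show ?thesis
    using True phi_0[OF \<alpha>] by (simp add: prob_space psi_def set_integral_at_point mult.commute)
next
  case False
  then interpret squared_bessel_process M F B X \<Delta> l \<gamma> x t \<alpha>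
    using assms by (intro squared_bessel_process.intro squared_bessel_process_axioms.intro) auto
  have "exp (- l * X t \<omega> - \<gamma> * (LBINT u:{0..t}. X u \<omega>)) = exp (- x * phi \<alpha> t l - psi \<alpha> \<Delta> t l) * exp (W \<omega>)" for \<omega>
    unfolding exp_add[symmetric] by (simp add: W_def mult.commute)
  then show ?thesis by (simp add: expectation_exp_W)
qed

end
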